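(* Let $K\ge 1$, $\Lambda\ge 1$, $\mathfrak L\ge 0$, $\mathcal B\ge 0$, $\Gamma\ge 0$ and $a\in\mathbf U$, where $\mathbf U=\{z\in\mathbf C:|z|<1\}$. Then there is a constant $C=C(K,\mathcal B,\Gamma,\Lambda,\mathfrak L,a)$, depending only on the listed quantities, with the following property. Let $A=(a^{ij})_{i,j=1}^2$ be a real symmetric matrix function on $\mathbf U$ such that $\Lambda^{-1}\le\langle A(z)h,h\rangle\le\Lambda$ for all $z\in\mathbf U$ and all $h\in\mathbf R^2$ with $|h|=1$, and $|A(z)-A(\zeta)|\le\mathfrak L|z-\zeta|$ for all $z,\zeta\in\mathbf U$, and let $L[w]=\sum_{i,j=1}^2 a^{ij}(z)D_{ij}w(z)$. Let $w:\mathbf U\to\mathbf U$ be a $C^2$ $K$-quasiconformal mapping with $w(\mathbf U)=\mathbf U$ and $w(a)=0$ such that $$|L[w](z)|\le\mathcal B|\nabla w(z)|^2+\Gamma\qquad\text{for all } z\in\mathbf U.$$ Then $|\nabla w(z)|\le C$ for all $z\in\mathbf U$, and $w$ is Lipschitz continuous on $\mathbf U$.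
   Context: For a $2\times 2$ real matrix $A$, $|A|=\max\{|Az|:z\in\mathbf R^2,|z|=1\}$ (operator norm) and $l(A)=\min\{|Az|:z\in\mathbf R^2,|z|=1\}$. For $w=u+iv$, $\nabla w=\begin{pmatrix}u_x&u_y\\ v_x&v_y\end{pmatrix}$, and $|\nabla w|$ is its operator norm. $D_{ij}$ denotes the second partial derivative with respect to the $i$-th and $j$-th real coordinates; $L$ acts on complex-valued functions componentwise (that is, complex-linearly), and $|L[w]|$ is the modulus of the resulting complex number. A sense-preserving homeomorphism $w:D\to\Omega$ between subdomains of $\mathbf C$ is $K$-quasiconformal ($K\ge1$) if its real and imaginary parts are ACL in $D$ (that is, for every closed rectangle $R\subset D$ with sides parallel to the axes, they are absolutely continuous on almost every horizontal and almost every vertical line in $R$) and $|\nabla w|\le K\,l(\nabla w)$ almost everywhere in $D$. *)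

theory Defs
  imports "HOL-Complex_Analysis.Complex_Analysis"
begin

definition coord_vec :: "2 \<Rightarrow> complex" where
  "coord_vec j = (if j = 1 then 1 else \<i>)"

definition partial :: "2 \<Rightarrow> (complex \<Rightarrow> 'a::real_normed_vector) \<Rightarrow> complex \<Rightarrow> 'a" where
  "partial j f z = vector_derivative (\<lambda>t::real. f (z + t *\<^sub>R coord_vec j)) (at 0)"

definition has_partial :: "2 \<Rightarrow> (complex \<Rightarrow> 'a::real_normed_vector) \<Rightarrow> complex \<Rightarrow> bool" where
  "has_partial j f z \<longleftrightarrow> (\<lambda>t::real. f (z + t *\<^sub>R coord_vec j)) differentiable (at 0)"

text \<open>Real \<open>C\<^sup>1\<close> and \<open>C\<^sup>2\<close> regularity, meant for open sets \<open>D\<close>.\<close>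

definition C1_on :: "complex set \<Rightarrow> (complex \<Rightarrow> 'a::real_normed_vector) \<Rightarrow> bool" where
  "C1_on D f \<longleftrightarrow> (\<forall>j. (\<forall>z\<in>D. has_partial j f z) \<and> continuous_on D (partial j f))"

definition C2_on :: "complex set \<Rightarrow> (complex \<Rightarrow> 'a::real_normed_vector) \<Rightarrow> bool" where
  "C2_on D f \<longleftrightarrow> C1_on D f \<and> (\<forall>j. C1_on D (partial j f))"

definition nabla :: "(complex \<Rightarrow> complex) \<Rightarrow> complex \<Rightarrow> real^2^2" where
  "nabla w z = vector
     [vector [partial 1 (\<lambda>\<zeta>. Re (w \<zeta>)) z, partial 2 (\<lambda>\<zeta>. Re (w \<zeta>)) z],
      vector [partial 1 (\<lambda>\<zeta>. Im (w \<zeta>)) z, partial 2 (\<lambda>\<zeta>. Im (w \<zeta>)) z]]"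

definition op_norm :: "real^2^2 \<Rightarrow> real" where
  "op_norm A = onorm (\<lambda>h. A *v h)"

text \<open>The infimum is attained, since the unit circle is compact.\<close>

definition min_stretch :: "real^2^2 \<Rightarrow> real" where
  "min_stretch A = (INF h\<in>sphere 0 1. norm (A *v h))"

definition second_order_op ::
  "(complex \<Rightarrow> real^2^2) \<Rightarrow> (complex \<Rightarrow> complex) \<Rightarrow> complex \<Rightarrow> complex" where
  "second_order_op A w z =
     (\<Sum>i\<in>UNIV. \<Sum>j\<in>UNIV. (A z $ i $ j) *\<^sub>R partial i (partial j w) z)"

text \<open>The \<open>\<epsilon>\<close>-\<open>\<delta>\<close> definition: \<open>d\<close> ranges over the finite families of non-overlapping compact
  subintervals \<open>k = {Inf k..Sup k}\<close> of the interval \<open>I\<close>.\<close>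

definition abs_continuous_on :: "real set \<Rightarrow> (real \<Rightarrow> real) \<Rightarrow> bool" where
  "abs_continuous_on I f \<longleftrightarrow>
     (\<forall>\<epsilon>>0. \<exists>\<delta>>0. \<forall>d. d division_of \<Union>d \<longrightarrow> \<Union>d \<subseteq> I \<longrightarrow>
        (\<Sum>k\<in>d. Sup k - Inf k) < \<delta> \<longrightarrow> (\<Sum>k\<in>d. \<bar>f (Sup k) - f (Inf k)\<bar>) < \<epsilon>)"

definition ACL_on :: "complex set \<Rightarrow> (complex \<Rightarrow> real) \<Rightarrow> bool" where
  "ACL_on D u \<longleftrightarrow> (\<forall>p q. cbox p q \<subseteq> D \<longrightarrow>
     (AE y in lborel. y \<in> {Im p..Im q} \<longrightarrow>
        abs_continuous_on {Re p..Re q} (\<lambda>x. u (Complex x y))) \<and>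
     (AE x in lborel. x \<in> {Re p..Re q} \<longrightarrow>
        abs_continuous_on {Im p..Im q} (\<lambda>y. u (Complex x y))))"

text \<open>For a homeomorphism, preserving the sense means having local degree \<open>1\<close>: the image of every
  positively oriented circle bounding a closed disc in \<open>D\<close> winds once, positively, around the
  image of the centre.\<close>

definition sense_preserving_homeo ::
  "complex set \<Rightarrow> complex set \<Rightarrow> (complex \<Rightarrow> complex) \<Rightarrow> bool" where
  "sense_preserving_homeo D \<Omega> w \<longleftrightarrow>
     (\<exists>g. homeomorphism D \<Omega> w g) \<and>
     (\<forall>z r. 0 < r \<longrightarrow> cball z r \<subseteq> D \<longrightarrow> winding_number (w \<circ> circlepath z r) (w z) = 1)"

text \<open>\<open>partial\<close> has an unspecified value where the partial derivative does not exist; for an ACL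
  mapping this happens only on a null set, which the dilatation condition ignores.\<close>

definition quasiconformal ::
  "real \<Rightarrow> complex set \<Rightarrow> complex set \<Rightarrow> (complex \<Rightarrow> complex) \<Rightarrow> bool" where
  "quasiconformal K D \<Omega> w \<longleftrightarrow>
     1 \<le> K \<and> D \<noteq> {} \<and> open D \<and> connected D \<and> open \<Omega> \<and> connected \<Omega> \<and>
     sense_preserving_homeo D \<Omega> w \<and>
     ACL_on D (\<lambda>z. Re (w z)) \<and> ACL_on D (\<lambda>z. Im (w z)) \<and>
     (AE z in lborel. z \<in> D \<longrightarrow> op_norm (nabla w z) \<le> K * min_stretch (nabla w z))"

end

theory Submission
  imports Defs
begin

text \<open>Write \<open>J\<close> for the Jacobian of \<open>w\<close> and \<open>F = |w\<^sub>x|\<^sup>2 + |w\<^sub>y|\<^sup>2\<close> for the squared Frobenius norm of its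
  gradient.  The proof stays with second derivative tests; the only integrals occur in one
  length-area estimate.

  For a \<open>C\<^sup>1\<close> map, quasiconformality yields the pointwise bound \<open>F \<le> 2 K |J|\<close>
  (\<open>quasiconformal_jacobian\<close>).  Since \<open>|J|\<close> is at most the product of the lengths of two
  complementary gradient components, a single component then controls the whole gradient
  (\<open>gradient_comparison\<close>): \<open>F \<le> 4 K\<^sup>2 |\<nabla> (Re w)|\<^sup>2\<close>, and the same with \<open>|w|\<^sup>2\<close> in place of \<open>Re w\<close> where
  \<open>|w| \<ge> 1/2\<close>.  The hypothesis on \<open>L[w]\<close> thereby turns into scalar inequalities
  \<open>|L u| \<le> B' |\<nabla> u|\<^sup>2 + \<Gamma>'\<close> for \<open>u = Re w\<close> and for \<open>u = |w|\<^sup>2\<close>.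

  For scalar functions there is an interior gradient bound (\<open>interior_gradient_bound\<close>): if \<open>u\<close>
  oscillates by at most \<open>M \<rho>\<close> on a ball of radius \<open>\<rho> \<le> 1\<close>, the gradient at the centre is bounded by
  a constant that involves \<open>M\<close> but not \<open>\<rho>\<close>.  This is the doubling of variables of Ishii and Lions:
  one looks at the maximum of \<open>u x - u y - \<phi> |x - y|\<close>, up to a localising term, for a concave
  modulus \<open>\<phi>\<close>.  Moving \<open>x\<close> and \<open>y\<close> towards each other gains \<open>4 \<phi>''\<close>, the Lipschitz continuity of \<open>A\<close>
  makes the loss from comparing \<open>A(x)\<close> with \<open>A(y)\<close> of order \<open>\<phi>'\<close>, and the quadratic growth costs
  \<open>\<phi>'\<^sup>2\<close>.  A logarithm satisfies \<open>\<phi>'' = - const \<cdot> \<phi>'\<^sup>2\<close>, so the gain beats all of these once \<open>\<phi>'\<close> is large.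

  Away from the unit circle the bound is applied to \<open>Re w\<close>.  Near the circle it is applied to
  \<open>|w|\<^sup>2\<close> on the ball around \<open>z\<close> of radius \<open>\<rho> = (1 - |z|)/2\<close>, which requires \<open>1 - |w|\<^sup>2 \<le> c (1 - |z|\<^sup>2)\<close>.
  That inequality is a maximum principle for \<open>exp (- m |w|\<^sup>2)\<close> against \<open>1 - |z|\<^sup>2\<close>
  (\<open>boundary_barrier\<close>).  Its constant depends on how close to the circle the set \<open>{|w| \<le> 1/2}\<close> can
  come, and this is controlled by \<open>K\<close> and \<open>a\<close> through the length-area method (\<open>preimage_radius\<close>): if \<open>w\<close> vanishes
  at \<open>a\<close> and \<open>|w z| \<le> 1/2\<close>, then each of a family of crosscuts of the disc separating \<open>a\<close> from \<open>z\<close> has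
  an image of length at least \<open>1/4\<close>, while \<open>F \<le> 2 K |J|\<close> bounds the squares of these lengths, summed
  over the family, by the area that the images sweep out, which is at most that of the disc.\<close>

section \<open>Second derivatives along lines\<close>

text \<open>The derivative is required on a whole neighbourhood of \<open>0\<close>, since the second derivative at \<open>0\<close> is the
  derivative of a function defined there; the values \<open>d1\<close> and \<open>d2\<close> are explicit so that sums and products of such
  functions can be computed by rules.\<close>

definition deriv2 :: "(real \<Rightarrow> real) \<Rightarrow> real \<Rightarrow> real \<Rightarrow> bool" where
  "deriv2 g d1 d2 \<longleftrightarrow> (\<exists>g'. (\<forall>\<^sub>F t in nhds 0. (g has_real_derivative g' t) (at t)) \<and>
     g' 0 = d1 \<and> (g' has_real_derivative d2) (at 0))"

lemma deriv2_add:
  assumes "deriv2 f a b" "deriv2 g c d"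
  shows "deriv2 (\<lambda>t. f t + g t) (a + c) (b + d)"
proof -
  obtain f' g' where f: "\<forall>\<^sub>F t in nhds 0. (f has_real_derivative f' t) (at t)" "f' 0 = a"
      "(f' has_real_derivative b) (at 0)"
    and g: "\<forall>\<^sub>F t in nhds 0. (g has_real_derivative g' t) (at t)" "g' 0 = c"
      "(g' has_real_derivative d) (at 0)"
    using assms unfolding deriv2_def by blast
  have "\<forall>\<^sub>F t in nhds 0. ((\<lambda>t. f t + g t) has_real_derivative f' t + g' t) (at t)"
    using f(1) g(1) by eventually_elim (auto intro: derivative_intros)
  moreover have "((\<lambda>t. f' t + g' t) has_real_derivative b + d) (at 0)"
    using f(3) g(3) by (auto intro: derivative_intros)
  ultimately show ?thesis
    unfolding deriv2_def using f(2) g(2) by (intro exI[of _ "\<lambda>t. f' t + g' t"]) auto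
qed

lemma deriv2_mult:
  assumes "deriv2 f a b" "deriv2 g c d"
  shows "deriv2 (\<lambda>t. f t * g t) (a * g 0 + f 0 * c) (b * g 0 + 2 * (a * c) + f 0 * d)"
proof -
  obtain f' g' where f: "\<forall>\<^sub>F t in nhds 0. (f has_real_derivative f' t) (at t)" "f' 0 = a"
      "(f' has_real_derivative b) (at 0)"
    and g: "\<forall>\<^sub>F t in nhds 0. (g has_real_derivative g' t) (at t)" "g' 0 = c"
      "(g' has_real_derivative d) (at 0)"
    using assms unfolding deriv2_def by blast
  have f0: "(f has_real_derivative a) (at 0)" and g0: "(g has_real_derivative c) (at 0)"
    using eventually_nhds_x_imp_x[OF f(1)] eventually_nhds_x_imp_x[OF g(1)] f(2) g(2) by auto
  have "\<forall>\<^sub>F t in nhds 0. ((\<lambda>t. f t * g t) has_real_derivative f' t * g t + f t * g' t) (at t)"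
    using f(1) g(1) by eventually_elim (auto intro!: derivative_eq_intros)
  moreover have "((\<lambda>t. f' t * g t + f t * g' t) has_real_derivative
      b * g 0 + 2 * (a * c) + f 0 * d) (at 0)"
    using f(3) g(3) f0 g0 f(2) g(2) by (auto intro!: derivative_eq_intros simp: algebra_simps)
  ultimately show ?thesis
    unfolding deriv2_def using f(2) g(2)
    by (intro exI[of _ "\<lambda>t. f' t * g t + f t * g' t"]) auto
qed

lemma deriv2_compose:
  assumes "deriv2 f a b"
    and F: "\<And>x. (F has_real_derivative F' x) (at x)" and F': "(F' has_real_derivative e) (at (f 0))"
  shows "deriv2 (\<lambda>t. F (f t)) (F' (f 0) * a) (e * a\<^sup>2 + F' (f 0) * b)"
proof -
  obtain f' where f: "\<forall>\<^sub>F t in nhds 0. (f has_real_derivative f' t) (at t)" "f' 0 = a"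
      "(f' has_real_derivative b) (at 0)"
    using assms unfolding deriv2_def by blast
  have f0: "(f has_real_derivative a) (at 0)"
    using eventually_nhds_x_imp_x[OF f(1)] f(2) by auto
  have "\<forall>\<^sub>F t in nhds 0. ((\<lambda>t. F (f t)) has_real_derivative F' (f t) * f' t) (at t)"
    using f(1) by eventually_elim (auto intro!: DERIV_chain2[OF F])
  moreover have "((\<lambda>t. F' (f t) * f' t) has_real_derivative
      e * a\<^sup>2 + F' (f 0) * b) (at 0)"
    using f(3) DERIV_chain2[OF F' f0] f(2)
    by (auto intro!: derivative_eq_intros simp: algebra_simps power2_eq_square)
  ultimately show ?thesis
    unfolding deriv2_def using f(2)
    by (intro exI[of _ "\<lambda>t. F' (f t) * f' t"]) auto
qed

lemma deriv2_quadratic: "deriv2 (\<lambda>t. a + b * t + c * t\<^sup>2) b (2 * c)"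
  unfolding deriv2_def
  by (rule exI[of _ "\<lambda>t. b + 2 * c * t"]) (auto intro!: derivative_eq_intros always_eventually)

lemma deriv2_cmult: "deriv2 f a b \<Longrightarrow> deriv2 (\<lambda>t. k * f t) (k * a) (k * b)"
  using deriv2_mult[of "\<lambda>t. k" 0 0 f a b] deriv2_quadratic[of k 0 0] by simp

lemma deriv2_diff:
  "deriv2 f a b \<Longrightarrow> deriv2 g c d \<Longrightarrow> deriv2 (\<lambda>t. f t - g t) (a - c) (b - d)"
  using deriv2_add[of f a b "\<lambda>t. - 1 * g t" "- 1 * c" "- 1 * d"] deriv2_cmult[of g c d "-1"] by simp

text \<open>If the second derivative were positive, the first derivative, which vanishes at \<open>0\<close>, would be
  positive just to the right of \<open>0\<close>, and the function would increase there.\<close>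

lemma deriv2_local_max:
  assumes g: "deriv2 g d1 d2" and mx: "\<forall>\<^sub>F t in nhds 0. g t \<le> g 0"
  shows "d1 = 0" "d2 \<le> 0"
proof -
  obtain g' where g': "\<forall>\<^sub>F t in nhds 0. (g has_real_derivative g' t) (at t)" "g' 0 = d1"
      "(g' has_real_derivative d2) (at 0)"
    using g unfolding deriv2_def by blast
  have "\<forall>\<^sub>F t in nhds 0. (g has_real_derivative g' t) (at t) \<and> g t \<le> g 0"
    using g'(1) mx by eventually_elim auto
  then obtain \<epsilon> where e: "\<epsilon> > 0" "\<And>t. \<bar>t\<bar> < \<epsilon> \<Longrightarrow> (g has_real_derivative g' t) (at t)"
    "\<And>t. \<bar>t\<bar> < \<epsilon> \<Longrightarrow> g t \<le> g 0"
    unfolding eventually_nhds_metric by (auto simp: dist_real_def)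
  show d1: "d1 = 0"
    using DERIV_local_max[of g "g' 0" 0 \<epsilon>] e g'(2) by auto
  show "d2 \<le> 0"
  proof (rule ccontr)
    assume "\<not> d2 \<le> 0"
    then obtain d where d: "d > 0" "\<And>h. 0 < h \<Longrightarrow> h < d \<Longrightarrow> g' 0 < g' (0 + h)"
      using DERIV_pos_inc_right[OF g'(3)] by auto
    define h where "h = min d \<epsilon> / 2"
    have h: "0 < h" "h < d" "h < \<epsilon>" using d e by (auto simp: h_def min_def)
    have "\<exists>z>0. z < h \<and> g h - g 0 = (h - 0) * g' z"
      by (rule MVT2) (use h e in auto)
    then obtain z where z: "0 < z" "z < h" "g h - g 0 = (h - 0) * g' z" by blast
    have "g' z > 0" using d(2)[of z] z h d1 g'(2) by auto
    then have "g h > g 0" using z h by (smt (verit) mult_pos_pos)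
    then show False using e(3)[of h] h by auto
  qed
qed

text \<open>The quadratic form of the symmetric matrix with rows \<open>(a, b)\<close> and \<open>(b, c)\<close>.\<close>

definition qf :: "real \<Rightarrow> real \<Rightarrow> real \<Rightarrow> complex \<Rightarrow> real" where
  "qf a b c \<xi> = a * (Re \<xi>)\<^sup>2 + 2 * b * Re \<xi> * Im \<xi> + c * (Im \<xi>)\<^sup>2"

text \<open>A second-order jet seen along lines only: gradient \<open>p\<close>, and Hessian with entries \<open>a\<close>, \<open>b\<close>, \<open>c\<close>.  This is all that a second derivative
  test uses, and it turns the calculus of jets into calculus in one real variable.\<close>

definition has_jet2 :: "(complex \<Rightarrow> real) \<Rightarrow> complex \<Rightarrow> real \<Rightarrow> real \<Rightarrow> real \<Rightarrow> complex \<Rightarrow> bool" where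
  "has_jet2 f p a b c z \<longleftrightarrow> (\<forall>\<xi>. deriv2 (\<lambda>t. f (z + t *\<^sub>R \<xi>)) (p \<bullet> \<xi>) (qf a b c \<xi>))"

text \<open>A positive semidefinite matrix is a sum of at most two matrices \<open>\<xi> \<xi>\<^sup>T\<close>, and pairing \<open>\<xi> \<xi>\<^sup>T\<close> with a
  second matrix evaluates the form of the latter at \<open>\<xi>\<close>.  For \<open>\<alpha> > 0\<close> the two vectors are
  \<open>(\<alpha>, \<beta>)\<close> and \<open>(0, 1)\<close>, up to scaling.\<close>

lemma trace_nonpos:
  assumes S: "\<And>\<xi>. 0 \<le> qf \<alpha> \<beta> \<gamma> \<xi>" and H: "\<And>\<xi>. qf a b c \<xi> \<le> 0"
  shows "\<alpha> * a + 2 * \<beta> * b + \<gamma> * c \<le> 0"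
proof -
  have c: "c \<le> 0" using H[of \<i>] by (simp add: qf_def)
  have al: "0 \<le> \<alpha>" using S[of 1] by (simp add: qf_def)
  have ga: "0 \<le> \<gamma>" using S[of \<i>] by (simp add: qf_def)
  show ?thesis
  proof (cases "\<alpha> = 0")
    case True
    have "\<beta> = 0"
    proof (rule ccontr)
      assume b: "\<beta> \<noteq> 0"
      have "0 \<le> qf \<alpha> \<beta> \<gamma> (Complex (- (\<gamma> + 1) / (2 * \<beta>)) 1)" by (rule S)
      also have "\<dots> = -1" using b True by (simp add: qf_def field_simps)
      finally show False by simp
    qed
    then show ?thesis using True c ga by (simp add: mult_nonneg_nonpos)
  next
    case False
    then have al: "\<alpha> > 0" using al by simp
    \<comment> \<open>Evaluating the form at the vector orthogonal to \<open>(\<alpha>, \<beta>)\<close> yields the determinant.\<close>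
    have "0 \<le> qf \<alpha> \<beta> \<gamma> (Complex (- \<beta>) \<alpha>)" by (rule S)
    also have "\<dots> = \<alpha> * (\<alpha> * \<gamma> - \<beta>\<^sup>2)" by (simp add: qf_def algebra_simps power2_eq_square)
    finally have det: "0 \<le> \<alpha> * \<gamma> - \<beta>\<^sup>2" using al by (simp add: zero_le_mult_iff)
    have "qf a b c (Complex \<alpha> \<beta>) + (\<alpha> * \<gamma> - \<beta>\<^sup>2) * c \<le> 0"
      using H[of "Complex \<alpha> \<beta>"] det c by (meson add_nonpos_nonpos mult_nonneg_nonpos)
    also have "qf a b c (Complex \<alpha> \<beta>) + (\<alpha> * \<gamma> - \<beta>\<^sup>2) * c = \<alpha> * (\<alpha> * a + 2 * \<beta> * b + \<gamma> * c)"
      by (simp add: qf_def algebra_simps power2_eq_square)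
    finally show ?thesis using al by (simp add: mult_le_0_iff)
  qed
qed

lemma norm_sq_complex_line: "(norm (z + t *\<^sub>R \<xi>))\<^sup>2 = (norm z)\<^sup>2 + 2 * (z \<bullet> \<xi>) * t + (norm \<xi>)\<^sup>2 * t\<^sup>2"
  for z \<xi> :: complex
  unfolding cmod_power2 inner_complex_def by (simp add: power2_eq_square algebra_simps)

text \<open>The first- and second-order conditions at a maximum of the doubled function.  Moving \<open>x\<close> along
  \<open>\<xi>\<close> and \<open>y\<close> along \<open>\<eta>\<close>, one may replace \<open>\<phi> |x - y|\<close> by any smooth majorant that agrees with it at the
  maximum: the tangent to \<open>\<phi>\<close> at \<open>r\<close>, followed by \<open>s \<le> (s\<^sup>2 + r\<^sup>2) / (2 r)\<close>, makes it a quadratic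
  polynomial.  The second derivative of \<open>\<phi>\<close> is lost in this step.  The last claim recovers it
  by moving \<open>x\<close> and \<open>y\<close> in the opposite directions \<open>e\<close> and \<open>- e\<close> along the segment between them, where
  \<open>|x - y|\<close> is an affine function of the parameter.\<close>

lemma doubling_jets:
  fixes u \<phi> :: "_ \<Rightarrow> real"
  assumes X: "has_jet2 u px ax bx cx x" and Y: "has_jet2 u py ay by cy y"
    and r: "r = norm (x - y)" "0 < r" and p: "0 \<le> p"
    and phi: "deriv2 (\<lambda>t. \<phi> (r + t)) p q"
    and tangent: "\<forall>s\<ge>0. \<phi> s \<le> \<phi> r + p * (s - r)"
    and mx: "\<forall>\<^sub>F (x', y') in nhds (x, y).
      u x' - u y' - \<phi> (norm (x' - y')) - \<kappa> * (norm (x' - z0))\<^sup>2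
        \<le> u x - u y - \<phi> r - \<kappa> * (norm (x - z0))\<^sup>2"
  shows "px = p *\<^sub>R sgn (x - y) + (2 * \<kappa>) *\<^sub>R (x - z0)" "py = p *\<^sub>R sgn (x - y)"
    "qf ax bx cx \<xi> - qf ay by cy \<eta> \<le> p / r * (norm (\<xi> - \<eta>))\<^sup>2 + 2 * \<kappa> * (norm \<xi>)\<^sup>2"
    "qf ax bx cx (sgn (x - y)) - qf ay by cy (sgn (x - y)) \<le> 4 * q + 2 * \<kappa>"
proof -
  have line: "\<forall>\<^sub>F t in nhds 0. u (x + t *\<^sub>R \<xi>) - u (y + t *\<^sub>R \<eta>)
      - \<phi> (norm (x + t *\<^sub>R \<xi> - (y + t *\<^sub>R \<eta>))) - \<kappa> * (norm (x + t *\<^sub>R \<xi> - z0))\<^sup>2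
        \<le> u x - u y - \<phi> r - \<kappa> * (norm (x - z0))\<^sup>2" for \<xi> \<eta>
  proof -
    have "((\<lambda>t::real. (x + t *\<^sub>R \<xi>, y + t *\<^sub>R \<eta>)) \<longlongrightarrow> (x + 0 *\<^sub>R \<xi>, y + 0 *\<^sub>R \<eta>)) (nhds 0)"
      by (intro tendsto_intros filterlim_ident)
    then have "filterlim (\<lambda>t::real. (x + t *\<^sub>R \<xi>, y + t *\<^sub>R \<eta>)) (nhds (x, y)) (nhds 0)" by simp
    from eventually_compose_filterlim[OF mx this] show ?thesis by simp
  qed
  have key: "px \<bullet> \<xi> - py \<bullet> \<eta> - p / r * ((x - y) \<bullet> (\<xi> - \<eta>)) - 2 * \<kappa> * ((x - z0) \<bullet> \<xi>) = 0 \<and>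
     qf ax bx cx \<xi> - qf ay by cy \<eta> - p / r * (norm (\<xi> - \<eta>))\<^sup>2 - 2 * \<kappa> * (norm \<xi>)\<^sup>2 \<le> 0" for \<xi> \<eta>
  proof -
    define g where "g = (\<lambda>t. (u (x + t *\<^sub>R \<xi>) - u (y + t *\<^sub>R \<eta>)) -
      (\<kappa> * (norm (x - z0))\<^sup>2 + (p / r * ((x - y) \<bullet> (\<xi> - \<eta>)) + 2 * \<kappa> * ((x - z0) \<bullet> \<xi>)) * t
        + (p / (2 * r) * (norm (\<xi> - \<eta>))\<^sup>2 + \<kappa> * (norm \<xi>)\<^sup>2) * t\<^sup>2))"
    have "deriv2 g ((px \<bullet> \<xi> - py \<bullet> \<eta>) - (p / r * ((x - y) \<bullet> (\<xi> - \<eta>)) + 2 * \<kappa> * ((x - z0) \<bullet> \<xi>)))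
      ((qf ax bx cx \<xi> - qf ay by cy \<eta>) - 2 * (p / (2 * r) * (norm (\<xi> - \<eta>))\<^sup>2 + \<kappa> * (norm \<xi>)\<^sup>2))"
      unfolding g_def using X Y unfolding has_jet2_def by (intro deriv2_diff deriv2_quadratic) auto
    moreover have "\<forall>\<^sub>F t in nhds 0. g t \<le> g 0"
      using line[of \<xi> \<eta>]
    proof eventually_elim
      case (elim t)
      define s where "s = norm (x + t *\<^sub>R \<xi> - (y + t *\<^sub>R \<eta>))"
      have ss: "s\<^sup>2 = r\<^sup>2 + 2 * ((x - y) \<bullet> (\<xi> - \<eta>)) * t + (norm (\<xi> - \<eta>))\<^sup>2 * t\<^sup>2"
        unfolding r s_def norm_sq_complex_line[symmetric] by (simp add: algebra_simps)
      \<comment> \<open>The arithmetic-geometric mean inequality, tangent at \<open>s = r\<close>.\<close>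
      have "0 \<le> (s - r)\<^sup>2" by simp
      then have "s - r \<le> (s\<^sup>2 - r\<^sup>2) / (2 * r)"
        using r by (simp add: field_simps power2_eq_square)
      then have "p * (s - r) \<le> p * ((s\<^sup>2 - r\<^sup>2) / (2 * r))" using p by (rule mult_left_mono)
      then have "\<phi> s \<le> \<phi> r + p * ((s\<^sup>2 - r\<^sup>2) / (2 * r))"
        using tangent[rule_format, of s] by (simp add: s_def)
      moreover have "p * ((s\<^sup>2 - r\<^sup>2) / (2 * r)) = p / r * ((x - y) \<bullet> (\<xi> - \<eta>)) * t
        + p / (2 * r) * (norm (\<xi> - \<eta>))\<^sup>2 * t\<^sup>2"
        unfolding ss using r by (simp add: field_simps)
      moreover have "(norm (x + t *\<^sub>R \<xi> - z0))\<^sup>2 = (norm (x - z0))\<^sup>2 + 2 * ((x - z0) \<bullet> \<xi>) * t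
         + (norm \<xi>)\<^sup>2 * t\<^sup>2"
        using norm_sq_complex_line[of "x - z0" t \<xi>] by (simp add: algebra_simps)
      moreover have "g t = (u (x + t *\<^sub>R \<xi>) - u (y + t *\<^sub>R \<eta>)) -
        (p / r * ((x - y) \<bullet> (\<xi> - \<eta>)) * t + p / (2 * r) * (norm (\<xi> - \<eta>))\<^sup>2 * t\<^sup>2) -
        \<kappa> * ((norm (x - z0))\<^sup>2 + 2 * ((x - z0) \<bullet> \<xi>) * t + (norm \<xi>)\<^sup>2 * t\<^sup>2)"
        unfolding g_def by (simp only: ring_distribs mult_ac)
      moreover have "g 0 = u x - u y - \<kappa> * (norm (x - z0))\<^sup>2" by (simp add: g_def)
      ultimately show ?case using elim unfolding s_def[symmetric] by simp
    qed
    ultimately show ?thesis using deriv2_local_max[of g] r by (fastforce simp: field_simps)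
  qed
  have sg: "sgn (x - y) = (1 / r) *\<^sub>R (x - y)" using r by (simp add: sgn_div_norm divide_inverse)
  have "(py - p *\<^sub>R sgn (x - y)) \<bullet> \<eta> = 0" for \<eta>
    using conjunct1[OF key[of 0 \<eta>]] by (simp add: sg inner_diff_left[of py] right_diff_distrib)
  then have "(py - p *\<^sub>R sgn (x - y)) \<bullet> (py - p *\<^sub>R sgn (x - y)) = 0" by blast
  then show "py = p *\<^sub>R sgn (x - y)" by simp
  have "(px - p *\<^sub>R sgn (x - y) - (2 * \<kappa>) *\<^sub>R (x - z0)) \<bullet> \<xi> = 0" for \<xi>
    using conjunct1[OF key[of \<xi> 0]]
    by (simp add: sg inner_diff_left[of px] inner_diff_left[of "px - _"] right_diff_distrib)
  then have "(px - p *\<^sub>R sgn (x - y) - (2 * \<kappa>) *\<^sub>R (x - z0)) \<bullet> (px - p *\<^sub>R sgn (x - y) - (2 * \<kappa>) *\<^sub>R (x - z0)) = 0" by blast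
  then have "px - p *\<^sub>R sgn (x - y) - (2 * \<kappa>) *\<^sub>R (x - z0) = 0" by (simp only: inner_eq_zero_iff)
  then show "px = p *\<^sub>R sgn (x - y) + (2 * \<kappa>) *\<^sub>R (x - z0)" by (simp add: algebra_simps)
  show "qf ax bx cx \<xi> - qf ay by cy \<eta> \<le> p / r * (norm (\<xi> - \<eta>))\<^sup>2 + 2 * \<kappa> * (norm \<xi>)\<^sup>2"
    using key[of \<xi> \<eta>] by linarith
  define e where "e = sgn (x - y)"
  have ne: "norm e = 1" using r by (auto simp: e_def norm_sgn)
  have xy: "x - y = r *\<^sub>R e" using r by (simp add: e_def sgn_div_norm)
  define g where "g = (\<lambda>t. ((u (x + t *\<^sub>R e) - u (y + t *\<^sub>R (- e))) - \<phi> (r + 2 * t)) -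
      (\<kappa> * (norm (x - z0))\<^sup>2 + (2 * \<kappa> * ((x - z0) \<bullet> e)) * t + \<kappa> * t\<^sup>2))"
  have "deriv2 (\<lambda>t. \<phi> (r + 2 * t)) (2 * p) (4 * q)"
  proof -
    obtain f' where f: "\<forall>\<^sub>F t in nhds 0. ((\<lambda>t. \<phi> (r + t)) has_real_derivative f' t) (at t)" "f' 0 = p"
      "(f' has_real_derivative q) (at 0)"
      using phi unfolding deriv2_def by blast
    have "filterlim (\<lambda>t::real. 2 * t) (nhds (2 * 0)) (nhds 0)"
      by (intro tendsto_intros filterlim_ident)
    then have "\<forall>\<^sub>F t in nhds 0. ((\<lambda>t. \<phi> (r + t)) has_real_derivative f' (2 * t)) (at (2 * t))"
      using eventually_compose_filterlim[OF f(1)] by simp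
    then have "\<forall>\<^sub>F t in nhds 0. ((\<lambda>t. \<phi> (r + 2 * t)) has_real_derivative 2 * f' (2 * t)) (at t)"
    proof eventually_elim
      case (elim t)
      have "((\<lambda>t. 2 * t) has_real_derivative 2) (at t)" by (auto intro!: derivative_eq_intros)
      from DERIV_chain2[where f = "\<lambda>t. \<phi> (r + t)" and g = "\<lambda>t. 2 * t", OF elim this]
      show ?case by (simp add: mult.commute)
    qed
    moreover have "((\<lambda>t. 2 * f' (2 * t)) has_real_derivative 4 * q) (at 0)"
    proof -
      have "((\<lambda>t. 2 * t) has_real_derivative 2) (at (0::real))"
        by (auto intro!: derivative_eq_intros)
      then have "((\<lambda>t. f' (2 * t)) has_real_derivative q * 2) (at 0)"
        by (intro DERIV_chain2[where f = f']) (use f(3) in auto)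
      then show ?thesis by (auto intro!: derivative_eq_intros)
    qed
    ultimately show ?thesis unfolding deriv2_def using f(2) by (intro exI[of _ "\<lambda>t. 2 * f' (2 * t)"]) auto
  qed
  note phi2 = this
  have "deriv2 g (((px \<bullet> e - py \<bullet> (- e)) - 2 * p) - 2 * \<kappa> * ((x - z0) \<bullet> e))
      (((qf ax bx cx e - qf ay by cy (- e)) - 4 * q) - 2 * \<kappa>)"
    unfolding g_def
    by (intro deriv2_diff deriv2_quadratic phi2 X[unfolded has_jet2_def, rule_format]
        Y[unfolded has_jet2_def, rule_format])
  moreover have "\<forall>\<^sub>F t in nhds 0. g t \<le> g 0"
  proof -
    have "\<forall>\<^sub>F t in nhds 0. t > - r / 2"
      using r by (intro order_tendstoD(1)[OF filterlim_ident]) auto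
    with line[of e "-e"] show ?thesis
    proof eventually_elim
      case (elim t)
      have "x + t *\<^sub>R e - (y + t *\<^sub>R (- e)) = (r + 2 * t) *\<^sub>R e"
        using xy by (simp add: complex_eq_iff algebra_simps)
      then have "norm (x + t *\<^sub>R e - (y + t *\<^sub>R (- e))) = r + 2 * t"
        using elim(2) ne r by (auto simp: abs_real_def)
      moreover have "(norm (x + t *\<^sub>R e - z0))\<^sup>2 = (norm (x - z0))\<^sup>2 + 2 * ((x - z0) \<bullet> e) * t + t\<^sup>2"
        using norm_sq_complex_line[of "x - z0" t e] ne by (simp add: algebra_simps)
      moreover have "g t = (u (x + t *\<^sub>R e) - u (y + t *\<^sub>R (- e))) - \<phi> (r + 2 * t) -
          \<kappa> * ((norm (x - z0))\<^sup>2 + 2 * ((x - z0) \<bullet> e) * t + t\<^sup>2)"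
        unfolding g_def by (simp only: ring_distribs mult_ac)
      moreover have "g 0 = u x - u y - \<phi> r - \<kappa> * (norm (x - z0))\<^sup>2" by (simp add: g_def)
      ultimately show ?case using elim(1) by simp
    qed
  qed
  ultimately have "((qf ax bx cx e - qf ay by cy (- e)) - 4 * q) - 2 * \<kappa> \<le> 0"
    using deriv2_local_max by blast
  then show "qf ax bx cx (sgn (x - y)) - qf ay by cy (sgn (x - y)) \<le> 4 * q + 2 * \<kappa>"
    unfolding e_def[symmetric] by (simp add: qf_def)
qed

section \<open>Interior gradient bound by doubling the variables\<close>

text \<open>Split off from both coefficient matrices the common part \<open>S = A(y) - \<sigma> I\<close>.  On \<open>S\<close> the Hessian
  inequality is used with \<open>\<xi> = \<eta>\<close>, where the term with \<open>P\<close> vanishes, except for the fraction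
  \<open>e e\<^sup>T / (2 \<Lambda>)\<close> of \<open>S\<close>, for which the stronger inequality in the direction \<open>e\<close> yields the gain
  \<open>(2/\<Lambda>) q\<close>.  The remainders \<open>A(x) - S\<close> and \<open>A(y) - S\<close> have size \<open>\<sigma>\<close> and are estimated separately,
  with \<open>\<eta> = 0\<close> and with \<open>\<xi> = 0\<close>; they contribute the loss \<open>6 \<sigma> P\<close>.\<close>

lemma trace_coupling:
  assumes H: "\<And>\<xi> \<eta>. qf ax bx cx \<xi> - qf ay by cy \<eta> \<le> P * (norm (\<xi> - \<eta>))\<^sup>2 + k * (norm \<xi>)\<^sup>2"
    and He: "qf ax bx cx e - qf ay by cy e \<le> 4 * q + k" and e: "norm e = 1"
    and Ax: "\<And>\<xi>. qf \<alpha> \<beta> \<gamma> \<xi> \<le> \<Lambda> * (norm \<xi>)\<^sup>2"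
    and Ay: "\<And>\<xi>. (norm \<xi>)\<^sup>2 / \<Lambda> \<le> qf \<alpha>' \<beta>' \<gamma>' \<xi>"
    and diff: "\<And>\<xi>. \<bar>qf (\<alpha> - \<alpha>') (\<beta> - \<beta>') (\<gamma> - \<gamma>') \<xi>\<bar> \<le> \<sigma> * (norm \<xi>)\<^sup>2"
    and \<sigma>: "\<sigma> \<le> 1 / (2 * \<Lambda>)" and "0 < \<Lambda>" "0 \<le> P" "0 \<le> k"
  shows "\<alpha> * ax + 2 * \<beta> * bx + \<gamma> * cx - (\<alpha>' * ay + 2 * \<beta>' * by + \<gamma>' * cy)
    \<le> 2 / \<Lambda> * q + 6 * \<sigma> * P + 2 * k * \<Lambda>"
proof -
  \<comment> \<open>The part of the ellipticity constant of \<open>A(y)\<close> that remains after subtracting \<open>\<sigma> \<le> 1 / (2 \<Lambda>)\<close>.\<close>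
  define c where "c = 1 / (2 * \<Lambda>)"
  have n2: "(norm \<xi>)\<^sup>2 = (Re \<xi>)\<^sup>2 + (Im \<xi>)\<^sup>2" for \<xi> :: complex by (rule cmod_power2)
  have \<sigma>0: "0 \<le> \<sigma>" using diff[of 1] by simp
  have ag: "\<alpha> \<le> \<Lambda>" "\<gamma> \<le> \<Lambda>" using Ax[of 1] Ax[of \<i>] by (auto simp: qf_def)
  have H': "qf (ax - k) bx (cx - k) \<xi> - qf ay by cy \<eta> \<le> P * (norm (\<xi> - \<eta>))\<^sup>2" for \<xi> \<eta>
    using H[of \<xi> \<eta>] by (simp add: qf_def n2[of \<xi>] algebra_simps)
  have Y: "- \<sigma> * (ay + cy) \<le> 2 * \<sigma> * P"
  proof -
    have "- ay \<le> P" "- cy \<le> P" using H'[of 0 1] H'[of 0 \<i>] by (auto simp: qf_def)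
    then have "- (ay + cy) \<le> 2 * P" by simp
    then have "\<sigma> * (- (ay + cy)) \<le> \<sigma> * (2 * P)" using \<sigma>0 by (rule mult_left_mono)
    then show ?thesis by (simp add: algebra_simps)
  qed
  have "(\<alpha> - \<alpha>' + \<sigma>) * (ax - k - P) + 2 * (\<beta> - \<beta>') * bx + (\<gamma> - \<gamma>' + \<sigma>) * (cx - k - P) \<le> 0"
  proof (rule trace_nonpos)
    show "0 \<le> qf (\<alpha> - \<alpha>' + \<sigma>) (\<beta> - \<beta>') (\<gamma> - \<gamma>' + \<sigma>) \<xi>" for \<xi>
      using diff[of \<xi>] by (simp add: qf_def n2 algebra_simps abs_le_iff)
    show "qf (ax - k - P) bx (cx - k - P) \<xi> \<le> 0" for \<xi>
      using H'[of \<xi> 0] by (simp add: qf_def n2 algebra_simps)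
  qed
  moreover have "P * (\<alpha> - \<alpha>' + \<sigma> + (\<gamma> - \<gamma>' + \<sigma>)) \<le> P * (4 * \<sigma>)"
    using diff[of 1] diff[of \<i>] \<open>0 \<le> P\<close> by (intro mult_left_mono) (auto simp: qf_def abs_le_iff)
  ultimately have X: "(\<alpha> - \<alpha>' + \<sigma>) * (ax - k) + 2 * (\<beta> - \<beta>') * bx + (\<gamma> - \<gamma>' + \<sigma>) * (cx - k) \<le> 4 * \<sigma> * P"
    by (simp add: algebra_simps)
  have "(\<alpha>' - \<sigma> - c * (Re e)\<^sup>2) * (ax - k - ay) + 2 * (\<beta>' - c * (Re e * Im e)) * (bx - by)
     + (\<gamma>' - \<sigma> - c * (Im e)\<^sup>2) * (cx - k - cy) \<le> 0"
  proof (rule trace_nonpos)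
    fix \<xi> :: complex
    have "(e \<bullet> \<xi>)\<^sup>2 \<le> (norm e * norm \<xi>)\<^sup>2"
      using Cauchy_Schwarz_ineq2[of e \<xi>] by (metis abs_ge_zero power2_abs power_mono)
    then have "c * (e \<bullet> \<xi>)\<^sup>2 \<le> c * (norm \<xi>)\<^sup>2"
      using e \<open>0 < \<Lambda>\<close> by (intro mult_left_mono) (auto simp: c_def)
    moreover have "\<sigma> * (norm \<xi>)\<^sup>2 \<le> c * (norm \<xi>)\<^sup>2" using mult_right_mono[OF \<sigma>, of "(norm \<xi>)\<^sup>2"] by (simp add: c_def)
    moreover have "c * (norm \<xi>)\<^sup>2 + c * (norm \<xi>)\<^sup>2 = (norm \<xi>)\<^sup>2 / \<Lambda>" using \<open>0 < \<Lambda>\<close> by (simp add: c_def field_simps)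
    ultimately have "0 \<le> qf \<alpha>' \<beta>' \<gamma>' \<xi> - \<sigma> * (norm \<xi>)\<^sup>2 - c * (e \<bullet> \<xi>)\<^sup>2" using Ay[of \<xi>] by linarith
    also have "\<dots> = qf (\<alpha>' - \<sigma> - c * (Re e)\<^sup>2) (\<beta>' - c * (Re e * Im e)) (\<gamma>' - \<sigma> - c * (Im e)\<^sup>2) \<xi>"
      unfolding n2 inner_complex_def by (simp add: qf_def power2_eq_square algebra_simps)
    finally show "0 \<le> \<dots>" .
    show "qf (ax - k - ay) (bx - by) (cx - k - cy) \<xi> \<le> 0"
      using H'[of \<xi> \<xi>] by (simp add: qf_def algebra_simps)
  qed
  moreover have "qf (ax - k - ay) (bx - by) (cx - k - cy) e =
      qf ax bx cx e - qf ay by cy e - k * ((Re e)\<^sup>2 + (Im e)\<^sup>2)"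
    by (simp add: qf_def algebra_simps)
  then have "c * qf (ax - k - ay) (bx - by) (cx - k - cy) e \<le> c * (4 * q)"
    using He e n2[of e] \<open>0 < \<Lambda>\<close> by (intro mult_left_mono) (auto simp: c_def)
  ultimately have S: "(\<alpha>' - \<sigma>) * (ax - k - ay) + 2 * \<beta>' * (bx - by) + (\<gamma>' - \<sigma>) * (cx - k - cy) \<le> c * (4 * q)"
    by (simp add: qf_def algebra_simps)
  have "k * (\<alpha> + \<gamma>) \<le> k * (2 * \<Lambda>)" using ag \<open>0 \<le> k\<close> by (intro mult_left_mono) auto
  moreover have "\<alpha> * ax + 2 * \<beta> * bx + \<gamma> * cx - (\<alpha>' * ay + 2 * \<beta>' * by + \<gamma>' * cy) =
     ((\<alpha>' - \<sigma>) * (ax - k - ay) + 2 * \<beta>' * (bx - by) + (\<gamma>' - \<sigma>) * (cx - k - cy)) +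
     ((\<alpha> - \<alpha>' + \<sigma>) * (ax - k) + 2 * (\<beta> - \<beta>') * bx + (\<gamma> - \<gamma>' + \<sigma>) * (cx - k)) + - \<sigma> * (ay + cy) + k * (\<alpha> + \<gamma>)"
    by (simp add: algebra_simps)
  moreover have "c * (4 * q) = 2 / \<Lambda> * q" by (simp add: c_def)
  ultimately show ?thesis using S X Y by linarith
qed

text \<open>Ellipticity and the Lipschitz condition for the coefficient matrix with rows \<open>(\<alpha>, \<beta>)\<close> and
  \<open>(\<beta>, \<gamma>)\<close>, both in terms of its quadratic form.\<close>

definition elliptic_on :: "complex set \<Rightarrow> real \<Rightarrow> real \<Rightarrow> (complex \<Rightarrow> real) \<Rightarrow> (complex \<Rightarrow> real) \<Rightarrow> (complex \<Rightarrow> real) \<Rightarrow> bool" where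
  "elliptic_on D \<Lambda> l \<alpha> \<beta> \<gamma> \<longleftrightarrow>
     (\<forall>z\<in>D. \<forall>\<xi>. (norm \<xi>)\<^sup>2 / \<Lambda> \<le> qf (\<alpha> z) (\<beta> z) (\<gamma> z) \<xi> \<and> qf (\<alpha> z) (\<beta> z) (\<gamma> z) \<xi> \<le> \<Lambda> * (norm \<xi>)\<^sup>2) \<and>
     (\<forall>x\<in>D. \<forall>y\<in>D. \<forall>\<xi>. \<bar>qf (\<alpha> x - \<alpha> y) (\<beta> x - \<beta> y) (\<gamma> x - \<gamma> y) \<xi>\<bar> \<le> l * norm (x - y) * (norm \<xi>)\<^sup>2)"

text \<open>The logarithmic modulus satisfies \<open>\<phi>'' = - (b/\<rho>) \<phi>'\<^sup>2\<close>.  Its value at a fixed distance grows without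
  bound, though only logarithmically, with its slope \<open>N\<close> at the origin.\<close>

lemma log_modulus:
  fixes \<rho> b N :: real
  assumes "0 < \<rho>" "0 < b" "0 < N" "0 \<le> r"
  defines "\<phi> \<equiv> \<lambda>r. \<rho> / b * ln (1 + b * N / \<rho> * r)" and "p \<equiv> N / (1 + b * N / \<rho> * r)"
  shows "0 < r \<Longrightarrow> deriv2 (\<lambda>t. \<phi> (r + t)) p (- (b / \<rho>) * p\<^sup>2)"
    and "0 \<le> s \<Longrightarrow> \<phi> s \<le> \<phi> r + p * (s - r)"
proof -
  define m where "m = b * N / \<rho>"
  have m: "0 < m" using assms by (simp add: m_def)
  have phi: "\<phi> = (\<lambda>r. \<rho> / b * ln (1 + m * r))" and p: "p = N / (1 + m * r)"
    by (simp_all add: \<phi>_def p_def m_def)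
  have N: "N = \<rho> / b * m" using assms by (simp add: m_def)
  show "deriv2 (\<lambda>t. \<phi> (r + t)) p (- (b / \<rho>) * p\<^sup>2)" if "0 < r"
    unfolding deriv2_def
  proof (intro exI conjI)
    have "\<forall>\<^sub>F t in nhds 0. t > - r"
      using that by (intro order_tendstoD(1)[OF filterlim_ident]) auto
    then show "\<forall>\<^sub>F t in nhds 0. ((\<lambda>t. \<phi> (r + t)) has_real_derivative N / (1 + m * (r + t))) (at t)"
    proof eventually_elim
      case (elim t)
      have "0 < 1 + m * (r + t)" using m elim by (intro add_pos_nonneg mult_nonneg_nonneg) auto
      then have "((\<lambda>t. ln (1 + m * (r + t))) has_real_derivative m / (1 + m * (r + t))) (at t)"
        by (auto intro!: derivative_eq_intros simp: divide_inverse)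
      from DERIV_cmult[OF this, of "\<rho> / b"] show ?case unfolding phi N by simp
    qed
    show "N / (1 + m * (r + 0)) = p" by (simp add: p)
    have "0 < 1 + m * r" using m that by (intro add_pos_nonneg mult_nonneg_nonneg) auto
    then show "((\<lambda>t. N / (1 + m * (r + t))) has_real_derivative - (b / \<rho>) * p\<^sup>2) (at 0)"
      unfolding p using assms
      by (auto intro!: derivative_eq_intros simp: field_simps power2_eq_square m_def)
  qed
  show "\<phi> s \<le> \<phi> r + p * (s - r)" if "0 \<le> s"
  proof -
    have a: "0 < 1 + m * r" "0 < 1 + m * s"
      using m that assms by (auto intro!: add_pos_nonneg mult_nonneg_nonneg)
    have "ln (1 + m * s) - ln (1 + m * r) = ln ((1 + m * s) / (1 + m * r))"
      using a by (simp add: ln_div)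
    also have "\<dots> \<le> (1 + m * s) / (1 + m * r) - 1"
      using a by (intro ln_le_minus_one) auto
    also have "\<dots> = m * (s - r) / (1 + m * r)" using a by (simp add: field_simps)
    finally have "\<rho> / b * (ln (1 + m * s) - ln (1 + m * r)) \<le> \<rho> / b * (m * (s - r) / (1 + m * r))"
      using assms by (intro mult_left_mono) auto
    also have "\<dots> = p * (s - r)" unfolding p N by simp
    finally show ?thesis unfolding phi by (simp add: right_diff_distrib)
  qed
qed

text \<open>The slope \<open>N\<close> at the origin of the modulus in the proof below.  The first factor is the lower
  bound that \<open>\<phi>'\<close> must keep as long as \<open>\<phi>\<close> stays below the oscillation, and the exponential compensates for the decay
  of \<open>\<phi>'\<close> over that range.\<close>

definition gradient_const :: "real \<Rightarrow> real \<Rightarrow> real \<Rightarrow> real \<Rightarrow> real \<Rightarrow> real" where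
  "gradient_const \<Lambda> l B \<Gamma> M =
     (4 + 8 * M + 2 * \<Lambda> * l) * exp (M * (\<Lambda> * (5 * B + 2 * \<Gamma> + 6 * l + 64 * M * \<Lambda> + 1)))"

text \<open>At a positive maximum of the doubled function, \<open>\<phi> |x - y| < M \<rho>\<close>.  By the choice of \<open>N\<close> this
  forces \<open>|x - y|\<close> to be small and \<open>P = \<phi>' |x - y|\<close> to be large compared with all the data, so that both
  gradients are at most \<open>2 P\<close>.  The two differential inequalities and \<open>trace_coupling\<close> then bound \<open>(2 b/\<Lambda>) P\<^sup>2\<close>
  by a smaller multiple of \<open>P\<^sup>2\<close>, after multiplication by \<open>\<rho>\<close>.  Hence there is no such maximum, and setting \<open>x = z0\<close> gives
  \<open>u z0 - u y \<le> \<phi> |z0 - y| \<le> N |z0 - y|\<close>.\<close>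

lemma interior_gradient_bound:
  fixes \<Lambda> l B \<Gamma> M :: real
  assumes "1 \<le> \<Lambda>" "0 \<le> l" "0 \<le> B" "0 \<le> \<Gamma>" "0 \<le> M"
    and \<rho>: "0 < \<rho>" "\<rho> \<le> 1"
    and ell: "elliptic_on (ball z0 \<rho>) \<Lambda> l \<alpha> \<beta> \<gamma>"
    and jet: "\<And>z. z \<in> ball z0 \<rho> \<Longrightarrow> has_jet2 u (p z) (a z) (h z) (c z) z"
    and eqn: "\<And>z. z \<in> ball z0 \<rho> \<Longrightarrow>
      \<bar>\<alpha> z * a z + 2 * \<beta> z * h z + \<gamma> z * c z\<bar> \<le> B * (norm (p z))\<^sup>2 + \<Gamma>"
    and cont: "continuous_on (ball z0 \<rho>) u"
    and osc: "\<And>x y. x \<in> ball z0 \<rho> \<Longrightarrow> y \<in> ball z0 \<rho> \<Longrightarrow> u x - u y \<le> M * \<rho>"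
  shows "norm (p z0) \<le> gradient_const \<Lambda> l B \<Gamma> M"
proof -
  define b where "b = \<Lambda> * (5 * B + 2 * \<Gamma> + 6 * l + 64 * M * \<Lambda> + 1)"
  define N0 where "N0 = 4 + 8 * M + 2 * \<Lambda> * l"
  define N where "N = N0 * exp (M * b)"
  \<comment> \<open>With this \<open>\<kappa>\<close> the localising term reaches the oscillation bound \<open>M \<rho>\<close> at distance \<open>\<rho>/4\<close> from \<open>z0\<close>.\<close>
  define \<kappa> where "\<kappa> = 16 * M / \<rho>"
  define \<phi> where "\<phi> = (\<lambda>r. \<rho> / b * ln (1 + b * N / \<rho> * r))"
  \<comment> \<open>\<open>b \<ge> 1\<close> makes \<open>|x - y|\<close> at most \<open>\<rho>/N0\<close> below.\<close>
  have "1 * 1 \<le> b" unfolding b_def using assms(1-5) by (intro mult_mono) auto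
  then have b: "1 \<le> b" by simp
  have N0: "4 \<le> N0" "8 * M \<le> N0" "2 * \<Lambda> * l \<le> N0" using assms(1-5) by (auto simp: N0_def)
  have "0 \<le> M * b" using assms(5) b by simp
  then have "N0 * 1 \<le> N" unfolding N_def using N0 by (intro mult_left_mono) auto
  then have N: "N0 \<le> N" "0 < N" using N0 by auto
  have k0: "0 \<le> \<kappa>" using assms(5) \<rho> by (simp add: \<kappa>_def)
  have pos: "0 < 1 + b * N / \<rho> * r" if "0 \<le> r" for r
    using that b N \<rho> by (intro add_pos_nonneg mult_nonneg_nonneg) auto
  have phi_nonneg: "0 \<le> \<phi> r" if "0 \<le> r" for r
    using that b N \<rho> unfolding \<phi>_def by (intro mult_nonneg_nonneg ln_ge_zero) auto
  have phi_small: "N0 < N / (1 + b * N / \<rho> * r)" "b * N0 * r < \<rho>" if "0 \<le> r" "\<phi> r < M * \<rho>" for r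
  proof -
    have "ln (1 + b * N / \<rho> * r) < M * b" using that(2) \<rho> b by (simp add: \<phi>_def field_simps)
    then have *: "1 + b * N / \<rho> * r < exp (M * b)"
      using pos[OF that(1)] by (metis exp_less_mono exp_ln)
    then have "N0 * (1 + b * N / \<rho> * r) < N" unfolding N_def using N0 by (intro mult_strict_left_mono) auto
    then show "N0 < N / (1 + b * N / \<rho> * r)" using pos[OF that(1)] by (simp add: pos_less_divide_eq)
    have "b * N / \<rho> * r < exp (M * b)" using * by simp
    then have "(b * N0 * r / \<rho>) * exp (M * b) < 1 * exp (M * b)" by (simp add: N_def mult_ac)
    then have "b * N0 * r / \<rho> < 1" by (simp only: mult_less_cancel_right) auto
    then show "b * N0 * r < \<rho>" using \<rho> by (simp add: field_simps)
  qed
  define \<Phi> where "\<Phi> = (\<lambda>(x, y). u x - u y - \<phi> (norm (x - y)) - \<kappa> * (norm (x - z0))\<^sup>2)"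
  have sub: "cball z0 (\<rho> / 4) \<subseteq> ball z0 \<rho>" "cball z0 (\<rho> / 2) \<subseteq> ball z0 \<rho>" using \<rho> by auto
  \<comment> \<open>The ball for \<open>y\<close> has twice the radius: if \<open>x\<close> is interior and \<open>|x - y| < \<rho>/4\<close>, then so is \<open>y\<close>.\<close>
  define S where "S = cball z0 (\<rho> / 4) \<times> cball z0 (\<rho> / 2)"
  have main: "\<Phi> w \<le> 0" if "w \<in> S" for w
  proof -
    have "continuous_on S \<Phi>"
      unfolding S_def \<Phi>_def \<phi>_def case_prod_beta
      using sub pos by (intro continuous_intros continuous_on_compose2[OF cont]) (auto simp: less_imp_neq[symmetric] dest!: spec)
    moreover have "compact S" unfolding S_def by (intro compact_Times) auto
    moreover have "S \<noteq> {}" using that by auto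
    ultimately obtain xy where xy: "xy \<in> S" "\<And>w. w \<in> S \<Longrightarrow> \<Phi> w \<le> \<Phi> xy"
      using continuous_attains_sup by metis
    obtain x y where xy_eq: "xy = (x, y)" by fastforce
    have "\<Phi> (x, y) \<le> 0"
    proof (rule ccontr)
      assume "\<not> \<Phi> (x, y) \<le> 0"
      then have gt: "0 < u x - u y - \<phi> (norm (x - y)) - \<kappa> * (norm (x - z0))\<^sup>2" by (simp add: \<Phi>_def)
      have x: "x \<in> cball z0 (\<rho> / 4)" "x \<in> ball z0 \<rho>" and y: "y \<in> cball z0 (\<rho> / 2)" "y \<in> ball z0 \<rho>"
        using xy(1) sub unfolding xy_eq S_def by auto
      define r where "r = norm (x - y)"
      define P where "P = N / (1 + b * N / \<rho> * r)"
      have kx: "0 \<le> \<kappa> * (norm (x - z0))\<^sup>2" using k0 by simp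
      have r: "0 < r" using gt kx phi_nonneg[of 0] by (cases "x = y") (auto simp: r_def)
      have "\<phi> r < M * \<rho>" using gt kx osc[OF x(2) y(2)] by (simp add: r_def)
      then have P: "N0 < P" and br: "b * N0 * r < \<rho>" using phi_small[of r] r by (auto simp: P_def)
      have r4: "r < \<rho> / 4"
      proof -
        have "1 * 4 * r \<le> b * N0 * r" using r b N0 by (intro mult_right_mono mult_mono) auto
        then show ?thesis using br by simp
      qed
      have lr: "l * r \<le> 1 / (2 * \<Lambda>)"
      proof -
        have "1 * (2 * \<Lambda> * l) * r \<le> b * N0 * r" using r b N0 assms(1,2) by (intro mult_right_mono mult_mono) auto
        then show ?thesis using br \<rho> assms(1) by (simp add: field_simps)
      qed
      have xin: "norm (x - z0) < \<rho> / 4"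
      proof (rule ccontr)
        assume "\<not> norm (x - z0) < \<rho> / 4"
        then have "(\<rho> / 4)\<^sup>2 \<le> (norm (x - z0))\<^sup>2" using \<rho> by (intro power_mono) auto
        then have "\<kappa> * (\<rho> / 4)\<^sup>2 \<le> \<kappa> * (norm (x - z0))\<^sup>2" using k0 by (rule mult_left_mono)
        moreover have "\<kappa> * (\<rho> / 4)\<^sup>2 = M * \<rho>" using \<rho> by (simp add: \<kappa>_def power2_eq_square)
        ultimately show False using gt osc[OF x(2) y(2)] phi_nonneg[of r] r by (simp add: r_def)
      qed
      have yin: "norm (y - z0) < \<rho> / 2"
        using r4 xin norm_triangle_ineq[of "y - x" "x - z0"] by (simp add: r_def norm_minus_commute)
      have "open (ball z0 (\<rho> / 4) \<times> ball z0 (\<rho> / 2))" by (intro open_Times) auto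
      moreover have "(x, y) \<in> ball z0 (\<rho> / 4) \<times> ball z0 (\<rho> / 2)" using xin yin by (auto simp: dist_norm norm_minus_commute)
      ultimately have "\<forall>\<^sub>F w in nhds (x, y). w \<in> ball z0 (\<rho> / 4) \<times> ball z0 (\<rho> / 2)"
        by (rule eventually_nhds_in_open)
      then have mx: "\<forall>\<^sub>F (x', y') in nhds (x, y).
      u x' - u y' - \<phi> (norm (x' - y')) - \<kappa> * (norm (x' - z0))\<^sup>2
        \<le> u x - u y - \<phi> r - \<kappa> * (norm (x - z0))\<^sup>2"
      proof eventually_elim
        case (elim w)
        then have "w \<in> S" by (auto simp: S_def)
        then show ?case using xy(2)[of w] by (auto simp: xy_eq \<Phi>_def r_def)
      qed
      have lm: "deriv2 (\<lambda>t. \<phi> (r + t)) P (- (b / \<rho>) * P\<^sup>2)"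
        "\<forall>s\<ge>0. \<phi> s \<le> \<phi> r + P * (s - r)"
        using log_modulus[of \<rho> b N r] \<rho> b N r unfolding \<phi>_def P_def by auto
      have P0: "0 \<le> P" using P N0 by simp
      note dj = doubling_jets[where \<phi> = \<phi>, OF jet[OF x(2)] jet[OF y(2)] r_def r P0 lm mx]
      have e: "norm (sgn (x - y)) = 1" using r by (auto simp: norm_sgn r_def)
      have E: "(norm \<xi>)\<^sup>2 / \<Lambda> \<le> qf (\<alpha> z) (\<beta> z) (\<gamma> z) \<xi>" "qf (\<alpha> z) (\<beta> z) (\<gamma> z) \<xi> \<le> \<Lambda> * (norm \<xi>)\<^sup>2"
        if "z \<in> ball z0 \<rho>" for z \<xi> using ell that unfolding elliptic_on_def by blast+
      have E2: "\<bar>qf (\<alpha> x - \<alpha> y) (\<beta> x - \<beta> y) (\<gamma> x - \<gamma> y) \<xi>\<bar> \<le> l * r * (norm \<xi>)\<^sup>2" for \<xi>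
        using ell x(2) y(2) unfolding elliptic_on_def r_def by blast
      have "\<alpha> x * a x + 2 * \<beta> x * h x + \<gamma> x * c x - (\<alpha> y * a y + 2 * \<beta> y * h y + \<gamma> y * c y)
         \<le> 2 / \<Lambda> * (- (b / \<rho>) * P\<^sup>2) + 6 * (l * r) * (P / r) + 2 * (2 * \<kappa>) * \<Lambda>"
        by (rule trace_coupling[OF dj(3,4) e E(2)[OF x(2)] E(1)[OF y(2)] E2 lr]) (use assms(1) P0 r k0 in auto)
      moreover have "6 * (l * r) * (P / r) = 6 * l * P" using r by simp
      moreover have "norm (p y) = P" unfolding dj(2) using e P0 by simp
      moreover have "norm (p x) \<le> 2 * P"
      proof -
        have "norm (p x) \<le> P + 2 * \<kappa> * norm (x - z0)"
          unfolding dj(1) using norm_triangle_ineq[of "P *\<^sub>R sgn (x - y)" "(2 * \<kappa>) *\<^sub>R (x - z0)"] e P0 k0 by simp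
        also have "2 * \<kappa> * norm (x - z0) \<le> 2 * \<kappa> * (\<rho> / 4)" using k0 xin by (intro mult_left_mono) auto
        also have "\<dots> = 8 * M" using \<rho> by (simp add: \<kappa>_def)
        finally show ?thesis using P N0 by simp
      qed
      then have "B * (norm (p x))\<^sup>2 \<le> B * (2 * P)\<^sup>2" using assms(3) by (intro mult_left_mono power_mono) auto
      ultimately have "2 / \<Lambda> * (b / \<rho>) * P\<^sup>2 \<le> 5 * B * P\<^sup>2 + 2 * \<Gamma> + 6 * l * P + 4 * \<kappa> * \<Lambda>"
        using eqn[OF x(2)] eqn[OF y(2)] by (simp add: power_mult_distrib abs_le_iff)
      also have "\<dots> \<le> 1 / \<rho> * (5 * B * P\<^sup>2 + 2 * \<Gamma> + 6 * l * P + 64 * M * \<Lambda>)"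
      proof -
        have "1 * (5 * B * P\<^sup>2 + 2 * \<Gamma> + 6 * l * P) \<le> 1 / \<rho> * (5 * B * P\<^sup>2 + 2 * \<Gamma> + 6 * l * P)"
          using assms(1-5) P0 \<rho> by (intro mult_right_mono) auto
        moreover have "4 * \<kappa> * \<Lambda> = 1 / \<rho> * (64 * M * \<Lambda>)" by (simp add: \<kappa>_def)
        ultimately show ?thesis by (simp only: distrib_left[of "1 / \<rho>" _ "64 * M * \<Lambda>"] mult_1_left add_le_cancel_right)
      qed
      also have "\<dots> \<le> 1 / \<rho> * ((5 * B + 2 * \<Gamma> + 6 * l + 64 * M * \<Lambda>) * P\<^sup>2)"
      proof (rule mult_left_mono)
        have P1: "1 \<le> P" using P N0 by simp
        then have P2: "1 \<le> P\<^sup>2" "P \<le> P\<^sup>2" by (auto simp: power2_eq_square mult_le_cancel_left1 intro: mult_ge1_I)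
        have "\<Gamma> * 1 \<le> \<Gamma> * P\<^sup>2" "l * P \<le> l * P\<^sup>2" "(M * \<Lambda>) * 1 \<le> (M * \<Lambda>) * P\<^sup>2"
          by (rule mult_left_mono; use P2 assms(1-5) in simp)+
        then show "5 * B * P\<^sup>2 + 2 * \<Gamma> + 6 * l * P + 64 * M * \<Lambda> \<le> (5 * B + 2 * \<Gamma> + 6 * l + 64 * M * \<Lambda>) * P\<^sup>2"
          by (simp add: algebra_simps)
      qed (use \<rho> in auto)
      also have "\<dots> < 1 / \<rho> * ((2 * b / \<Lambda>) * P\<^sup>2)"
      proof -
        define T where "T = 5 * B + 2 * \<Gamma> + 6 * l + 64 * M * \<Lambda>"
        have "2 * b / \<Lambda> = 2 * (T + 1)" using assms(1) by (simp add: b_def T_def)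
        moreover have "0 \<le> T" using assms(1-5) by (simp add: T_def)
        ultimately have "T < 2 * b / \<Lambda>" by simp
        then have "5 * B + 2 * \<Gamma> + 6 * l + 64 * M * \<Lambda> < 2 * b / \<Lambda>" by (simp only: T_def)
        then show ?thesis using \<rho> P N0 by (intro mult_strict_left_mono mult_strict_right_mono) auto
      qed
      finally show False by (simp add: field_simps)
    qed
    then show ?thesis using xy(2)[OF that] xy_eq by simp
  qed
  show ?thesis
  proof (rule ccontr)
    assume "\<not> ?thesis"
    then have gt: "N < norm (p z0)" by (simp add: N_def N0_def b_def gradient_const_def)
    \<comment> \<open>A gradient longer than \<open>N\<close> would make \<open>u\<close> decrease from \<open>z0\<close> faster than the modulus permits.\<close>
    define e where "e = - sgn (p z0)"
    have ne: "norm e = 1" using gt N by (auto simp: e_def norm_sgn)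
    define g where "g = (\<lambda>t. u (z0 + t *\<^sub>R e) + N * t)"
    have z0: "z0 \<in> ball z0 \<rho>" using \<rho> by simp
    from jet[OF z0] have "deriv2 (\<lambda>t. u (z0 + t *\<^sub>R e)) (p z0 \<bullet> e) (qf (a z0) (h z0) (c z0) e)"
      unfolding has_jet2_def by blast
    then obtain g' where g': "\<forall>\<^sub>F t in nhds 0. ((\<lambda>t. u (z0 + t *\<^sub>R e)) has_real_derivative g' t) (at t)" "g' 0 = p z0 \<bullet> e"
      unfolding deriv2_def by blast
    from eventually_nhds_x_imp_x[OF g'(1)] g'(2)
    have "((\<lambda>t. u (z0 + t *\<^sub>R e)) has_real_derivative p z0 \<bullet> e) (at 0)" by simp
    then have "(g has_real_derivative (p z0 \<bullet> e + N)) (at 0)"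
      unfolding g_def by (auto intro!: derivative_eq_intros)
    moreover have "p z0 \<bullet> e = - norm (p z0)"
      unfolding e_def sgn_div_norm inner_minus_right inner_scaleR_right dot_square_norm power2_eq_square
      using gt N by (auto intro: left_inverse)
    ultimately obtain d where d: "d > 0" "\<And>t. 0 < t \<Longrightarrow> t < d \<Longrightarrow> g (0 + t) < g 0"
      using DERIV_neg_dec_right[of g "p z0 \<bullet> e + N" 0] gt by auto
    define t where "t = min d (\<rho> / 2) / 2"
    have t: "0 < t" "t < d" "t < \<rho> / 2" using d \<rho> by (auto simp: t_def min_def)
    have "(z0, z0 + t *\<^sub>R e) \<in> S" using t ne \<rho> by (simp add: S_def dist_norm)
    from main[OF this] have "u z0 - u (z0 + t *\<^sub>R e) \<le> \<phi> t"
      using t ne by (simp add: \<Phi>_def)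
    also have "\<phi> t \<le> N * t"
      using log_modulus(2)[of \<rho> b N 0 t] t \<rho> b N by (simp add: \<phi>_def)
    finally have "g t \<ge> g 0" by (simp add: g_def)
    then show False using d(2)[of t] t by simp
  qed
qed

section \<open>Second-order jets of \<open>C\<^sup>2\<close> maps\<close>

lemma has_partialD:
  assumes "has_partial j f z"
  shows "((\<lambda>t::real. f (z + t *\<^sub>R coord_vec j)) has_vector_derivative partial j f z) (at 0)"
  using assms unfolding has_partial_def partial_def by (simp add: vector_derivative_works)

text \<open>Continuous partial derivatives give differentiability, here transferred from the product
  \<open>\<real> \<times> \<real>\<close> to the complex plane.\<close>

lemma C1_on_has_derivative:
  assumes f: "C1_on D f" and D: "open D" "z \<in> D"
  shows "(f has_derivative (\<lambda>h. Re h *\<^sub>R partial 1 f z + Im h *\<^sub>R partial 2 f z)) (at z)"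
proof -
  obtain e where e: "e > 0" "ball z e \<subseteq> D" using D open_contains_ball by blast
  define X where "X = {Re z - e / 2<..<Re z + e / 2}"
  define Y where "Y = {Im z - e / 2<..<Im z + e / 2}"
  have XY: "Complex x y \<in> D" if "x \<in> X" "y \<in> Y" for x y
  proof -
    have "norm (Complex x y - z) \<le> \<bar>x - Re z\<bar> + \<bar>y - Im z\<bar>"
      using cmod_le[of "Complex x y - z"] by simp
    also have "\<dots> < e" using that by (auto simp: X_def Y_def)
    finally show ?thesis using e(2) by (auto simp: dist_norm norm_minus_commute)
  qed
  have zX: "Re z \<in> X" "Im z \<in> Y" using e by (auto simp: X_def Y_def)
  have d1: "((\<lambda>x. f (Complex x y)) has_vector_derivative partial 1 f (Complex x y)) (at x)"
    if "x \<in> X" "y \<in> Y" for x y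
  proof -
    have 0: "((\<lambda>t::real. f (Complex x y + t *\<^sub>R coord_vec 1)) has_vector_derivative partial 1 f (Complex x y)) (at (x - x))"
      using has_partialD f XY[OF that] unfolding C1_on_def by fastforce
    have "((\<lambda>t. t - x) has_vector_derivative 1) (at x)" by (auto intro!: derivative_eq_intros)
    note vector_diff_chain_at[OF this, of "\<lambda>t. f (Complex x y + t *\<^sub>R coord_vec 1)", OF 0]
    moreover have "Complex x y + (t - x) *\<^sub>R coord_vec 1 = Complex t y" for t
      by (simp add: coord_vec_def complex_eq_iff)
    ultimately show ?thesis by (simp add: o_def)
  qed
  have d2: "((\<lambda>y. f (Complex x y)) has_vector_derivative partial 2 f (Complex x y)) (at y)"
    if "x \<in> X" "y \<in> Y" for x y
  proof -
    have 0: "((\<lambda>t::real. f (Complex x y + t *\<^sub>R coord_vec 2)) has_vector_derivative partial 2 f (Complex x y)) (at (y - y))"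
      using has_partialD f XY[OF that] unfolding C1_on_def by fastforce
    have "((\<lambda>t. t - y) has_vector_derivative 1) (at y)" by (auto intro!: derivative_eq_intros)
    note vector_diff_chain_at[OF this, of "\<lambda>t. f (Complex x y + t *\<^sub>R coord_vec 2)", OF 0]
    moreover have "Complex x y + (t - y) *\<^sub>R coord_vec 2 = Complex x t" for t
      by (simp add: coord_vec_def complex_eq_iff)
    ultimately show ?thesis by (simp add: o_def)
  qed
  have cont2: "continuous (at (Re z, Im z) within X \<times> Y) (\<lambda>(x, y). blinfun_scaleR_left (partial 2 f (Complex x y)))"
  proof -
    have "continuous_on (X \<times> Y) (\<lambda>p. partial 2 f (Complex (fst p) (snd p)))"
    proof (rule continuous_on_compose2[of D "partial 2 f"])
      show "continuous_on D (partial 2 f)" using f unfolding C1_on_def by blast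
      show "continuous_on (X \<times> Y) (\<lambda>p. Complex (fst p) (snd p))"
        by (intro continuous_on_Complex continuous_on_fst continuous_on_snd continuous_on_id)
      show "(\<lambda>p. Complex (fst p) (snd p)) ` (X \<times> Y) \<subseteq> D" using XY by (force simp del: Complex_eq)
    qed
    then have "continuous_on (X \<times> Y) (\<lambda>p. blinfun_scaleR_left (partial 2 f (Complex (fst p) (snd p))))"
      by (intro bounded_linear.continuous_on[OF bounded_linear_blinfun_scaleR_left])
    then show ?thesis using zX unfolding split_beta' continuous_on_eq_continuous_within by blast
  qed
  have "((\<lambda>(x, y). f (Complex x y)) has_derivative
      (\<lambda>(tx, ty). tx *\<^sub>R partial 1 f (Complex (Re z) (Im z)) +
         blinfun_apply (blinfun_scaleR_left (partial 2 f (Complex (Re z) (Im z)))) ty)) (at (Re z, Im z) within X \<times> Y)"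
  proof (rule has_derivative_partialsI[where fy = "\<lambda>x y. blinfun_scaleR_left (partial 2 f (Complex x y))"])
    show "((\<lambda>x. f (Complex x (Im z))) has_derivative (\<lambda>tx. tx *\<^sub>R partial 1 f (Complex (Re z) (Im z)))) (at (Re z) within X)"
      using d1[OF zX] by (auto simp: has_vector_derivative_def intro: has_derivative_at_withinI)
    show "((\<lambda>y. f (Complex x y)) has_derivative blinfun_apply (blinfun_scaleR_left (partial 2 f (Complex x y)))) (at y within Y)"
      if "x \<in> X" "y \<in> Y" for x y
      using d2[OF that] by (auto simp: has_vector_derivative_def intro: has_derivative_at_withinI)
  qed (use zX cont2 in \<open>auto simp: Y_def\<close>)
  moreover have "at (Re z, Im z) within X \<times> Y = at (Re z, Im z)"
    using zX by (intro at_within_open open_Times) (auto simp: X_def Y_def)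
  ultimately have F: "((\<lambda>(x, y). f (Complex x y)) has_derivative
      (\<lambda>(tx, ty). tx *\<^sub>R partial 1 f z + ty *\<^sub>R partial 2 f z)) (at (Re z, Im z))"
    by (simp only: complex_surj blinfun_scaleR_left.rep_eq)
  have "((\<lambda>z. (Re z, Im z)) has_derivative (\<lambda>h. (Re h, Im h))) (at z)"
    by (intro has_derivative_Pair bounded_linear_imp_has_derivative bounded_linear_Re bounded_linear_Im)
  from has_derivative_compose[OF this F] show ?thesis
    by (simp only: prod.case complex_surj)
qed

lemma C1_on_line:
  assumes f: "C1_on D f" and D: "open D" "z + t *\<^sub>R \<xi> \<in> D"
  shows "((\<lambda>t. f (z + t *\<^sub>R \<xi>)) has_vector_derivative
     (Re \<xi> *\<^sub>R partial 1 f (z + t *\<^sub>R \<xi>) + Im \<xi> *\<^sub>R partial 2 f (z + t *\<^sub>R \<xi>))) (at t)"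
proof -
  have "((\<lambda>t. z + t *\<^sub>R \<xi>) has_derivative (\<lambda>h. h *\<^sub>R \<xi>)) (at t)"
    by (auto intro!: derivative_eq_intros)
  from has_derivative_compose[OF this C1_on_has_derivative[OF f D]]
  show ?thesis by (simp add: has_vector_derivative_def scaleR_add_right)
qed

text \<open>The functional \<open>L\<close> will be \<open>Re\<close> or \<open>Im\<close>.  Only the sum of the two mixed derivatives enters the second derivative
  along a line, so the off-diagonal entry of the jet is their mean.\<close>

lemma C2_on_has_jet2:
  assumes f: "C2_on D f" and D: "open D" "z \<in> D" and L: "bounded_linear L"
  shows "has_jet2 (\<lambda>z. L (f z)) (Complex (L (partial 1 f z)) (L (partial 2 f z)))
    (L (partial 1 (partial 1 f) z)) ((L (partial 1 (partial 2 f) z) + L (partial 2 (partial 1 f) z)) / 2)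
    (L (partial 2 (partial 2 f) z)) z"
  unfolding has_jet2_def
proof
  fix \<xi> :: complex
  interpret L: bounded_linear L by fact
  have C1: "C1_on D f" "\<And>j. C1_on D (partial j f)" using f by (auto simp: C2_on_def)
  define g' where "g' = (\<lambda>t. L (Re \<xi> *\<^sub>R partial 1 f (z + t *\<^sub>R \<xi>) + Im \<xi> *\<^sub>R partial 2 f (z + t *\<^sub>R \<xi>)))"
  have "((\<lambda>t. z + t *\<^sub>R \<xi>) \<longlongrightarrow> z + 0 *\<^sub>R \<xi>) (nhds (0::real))"
    by (intro tendsto_intros filterlim_ident)
  then have "\<forall>\<^sub>F t in nhds (0::real). z + t *\<^sub>R \<xi> \<in> D"
    using D by (auto dest!: topological_tendstoD)
  then have "\<forall>\<^sub>F t in nhds 0. ((\<lambda>t. L (f (z + t *\<^sub>R \<xi>))) has_real_derivative g' t) (at t)"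
  proof eventually_elim
    case (elim t)
    from L.has_vector_derivative[OF C1_on_line[OF C1(1) D(1) elim]]
    show ?case unfolding g'_def by (simp add: has_real_derivative_iff_has_vector_derivative)
  qed
  moreover have "g' 0 = Complex (L (partial 1 f z)) (L (partial 2 f z)) \<bullet> \<xi>"
    by (simp add: g'_def L.add L.scaleR inner_complex_def)
  moreover have "(g' has_real_derivative
      qf (L (partial 1 (partial 1 f) z)) ((L (partial 1 (partial 2 f) z) + L (partial 2 (partial 1 f) z)) / 2)
    (L (partial 2 (partial 2 f) z)) \<xi>) (at 0)"
  proof -
    have "((\<lambda>t. partial j f (z + t *\<^sub>R \<xi>)) has_vector_derivative
      (Re \<xi> *\<^sub>R partial 1 (partial j f) z + Im \<xi> *\<^sub>R partial 2 (partial j f) z)) (at 0)" for j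
      using C1_on_line[OF C1(2)[of j] D(1), of z 0 \<xi>] D(2) by simp
    then have "((\<lambda>t. Re \<xi> *\<^sub>R partial 1 f (z + t *\<^sub>R \<xi>) + Im \<xi> *\<^sub>R partial 2 f (z + t *\<^sub>R \<xi>)) has_vector_derivative
      (Re \<xi> *\<^sub>R (Re \<xi> *\<^sub>R partial 1 (partial 1 f) z + Im \<xi> *\<^sub>R partial 2 (partial 1 f) z) +
       Im \<xi> *\<^sub>R (Re \<xi> *\<^sub>R partial 1 (partial 2 f) z + Im \<xi> *\<^sub>R partial 2 (partial 2 f) z))) (at 0)"
      by (intro has_vector_derivative_add bounded_linear.has_vector_derivative[OF bounded_linear_scaleR_right])
    from L.has_vector_derivative[OF this] show ?thesis
      unfolding has_real_derivative_iff_has_vector_derivative g'_def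
      by (rule has_vector_derivative_eq_rhs) (simp add: L.add L.scaleR qf_def power2_eq_square algebra_simps add_divide_distrib)
  qed
  ultimately show "deriv2 (\<lambda>t. L (f (z + t *\<^sub>R \<xi>))) (Complex (L (partial 1 f z)) (L (partial 2 f z)) \<bullet> \<xi>)
      (qf (L (partial 1 (partial 1 f) z)) ((L (partial 1 (partial 2 f) z) + L (partial 2 (partial 1 f) z)) / 2)
    (L (partial 2 (partial 2 f) z)) \<xi>)"
    unfolding deriv2_def by (intro exI[of _ g'] conjI)
qed

lemma partial_bounded_linear:
  assumes "has_partial j f z" "bounded_linear L"
  shows "partial j (\<lambda>\<zeta>. L (f \<zeta>)) z = L (partial j f z)"
  unfolding partial_def[of j "\<lambda>\<zeta>. L (f \<zeta>)"]
  by (intro vector_derivative_at bounded_linear.has_vector_derivative[OF assms(2)] has_partialD assms(1))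

section \<open>Quasiconformality as a pointwise bound\<close>

lemma norm_vec2: "norm (x :: real^2) = sqrt ((x $ 1)\<^sup>2 + (x $ 2)\<^sup>2)"
  by (simp add: norm_vec_def L2_set_def sum_2)

text \<open>Rotating an orthonormal frame by a right angle reverses the sign of the inner product of the
  image vectors, so some frame has orthogonal images.  Their lengths \<open>P\<close> and \<open>Q\<close> are the singular
  values: \<open>P Q\<close> is the Jacobian and \<open>P\<^sup>2 + Q\<^sup>2\<close> the squared Frobenius norm, while the hypothesis makes each
  of them at most \<open>K\<close> times the other.\<close>

lemma distortion_jacobian:
  fixes a b c d K :: real
  defines "M \<equiv> vector [vector [a, b], vector [c, d]] :: real^2^2"
  assumes qc: "op_norm M \<le> K * min_stretch M" and K: "0 \<le> K"
  shows "a\<^sup>2 + b\<^sup>2 + c\<^sup>2 + d\<^sup>2 \<le> 2 * K * \<bar>a * d - b * c\<bar>"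
proof -
  \<comment> \<open>The inner product of the images of the frame rotated by \<open>t\<close>.\<close>
  define q where "q = (\<lambda>t. (a * cos t + b * sin t) * (b * cos t - a * sin t) + (c * cos t + d * sin t) * (d * cos t - c * sin t))"
  have "\<exists>t\<ge>0. t \<le> pi / 2 \<and> q t = 0"
  proof (cases "q 0 \<le> 0")
    case True
    then show ?thesis by (intro IVT') (auto simp: q_def mult.commute intro!: continuous_intros)
  next
    case False
    then show ?thesis by (intro IVT2') (auto simp: q_def mult.commute intro!: continuous_intros)
  qed
  then obtain t where t: "q t = 0" by blast
  define x y where "x = cos t" and "y = sin t"
  have xy: "x\<^sup>2 + y\<^sup>2 = 1" by (simp add: x_def y_def)
  define P where "P = norm (M *v vector [x, y])"
  define Q where "Q = norm (M *v vector [- y, x])"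
  have Mv: "M *v vector [r, s] = vector [a * r + b * s, c * r + d * s]" for r s
    by (simp add: M_def vec_eq_iff forall_2 matrix_vector_mult_def sum_2 vector_2)
  have P2: "P\<^sup>2 = (a * x + b * y)\<^sup>2 + (c * x + d * y)\<^sup>2" and Q2: "Q\<^sup>2 = (b * x - a * y)\<^sup>2 + (d * x - c * y)\<^sup>2"
    unfolding P_def Q_def Mv norm_vec2 by (simp_all add: vector_2)
  have nonneg: "0 \<le> P" "0 \<le> Q" by (simp_all add: P_def Q_def)
  have sum: "P\<^sup>2 + Q\<^sup>2 = a\<^sup>2 + b\<^sup>2 + c\<^sup>2 + d\<^sup>2"
  proof -
    have "P\<^sup>2 + Q\<^sup>2 = (a\<^sup>2 + b\<^sup>2 + c\<^sup>2 + d\<^sup>2) * (x\<^sup>2 + y\<^sup>2)"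
      unfolding P2 Q2 by (simp add: power2_eq_square algebra_simps)
    then show ?thesis by (simp add: xy)
  qed
  have prod: "P * Q = \<bar>a * d - b * c\<bar>"
  proof -
    have "(P * Q)\<^sup>2 = ((a * d - b * c) * (x\<^sup>2 + y\<^sup>2))\<^sup>2 + (q t)\<^sup>2"
      unfolding power_mult_distrib[of P Q] P2 Q2 q_def x_def[symmetric] y_def[symmetric]
      by (simp add: power2_eq_square algebra_simps)
    then have "(P * Q)\<^sup>2 = (a * d - b * c)\<^sup>2" by (simp add: t xy)
    then show ?thesis using nonneg by (metis abs_of_nonneg mult_nonneg_nonneg power2_eq_iff_nonneg abs_ge_zero power2_abs)
  qed
  have bd: "bdd_below ((\<lambda>h. norm (M *v h)) ` sphere 0 1)" by (intro bdd_belowI[of _ 0]) auto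
  have up: "norm (M *v h) \<le> K * norm (M *v k)" if "norm h = 1" "norm k = 1" for h k
  proof -
    have "norm (M *v h) \<le> op_norm M"
      using onorm[OF matrix_vector_mul_bounded_linear, of M h] that by (simp add: op_norm_def)
    also have "\<dots> \<le> K * min_stretch M" by fact
    also have "min_stretch M \<le> norm (M *v k)"
      unfolding min_stretch_def using that by (intro cINF_lower bd) auto
    finally show ?thesis using K by (simp add: mult_left_mono)
  qed
  have n: "norm (vector [x, y] :: real^2) = 1" "norm (vector [- y, x] :: real^2) = 1"
    using xy by (simp_all add: norm_vec2 vector_2 add.commute)
  have "P \<le> K * Q" "Q \<le> K * P" using up n unfolding P_def Q_def by auto
  then have "P * P \<le> (K * Q) * P" "Q * Q \<le> (K * P) * Q" using nonneg by (auto intro: mult_right_mono)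
  then show ?thesis unfolding sum[symmetric] prod[symmetric] by (simp add: power2_eq_square mult_ac)
qed

lemma op_norm_le_frobenius:
  "op_norm (vector [vector [a, b], vector [c, d]] :: real^2^2) \<le> sqrt (a\<^sup>2 + b\<^sup>2 + c\<^sup>2 + d\<^sup>2)"
  unfolding op_norm_def
proof (rule onorm_le)
  fix h :: "real^2"
  let ?M = "vector [vector [a, b], vector [c, d]] :: real^2^2"
  have Mv: "(?M *v h) $ 1 = a * h $ 1 + b * h $ 2" "(?M *v h) $ 2 = c * h $ 1 + d * h $ 2"
    by (simp_all add: matrix_vector_mult_def sum_2 vector_2)
  have "(a * h $ 1 + b * h $ 2)\<^sup>2 + (c * h $ 1 + d * h $ 2)\<^sup>2 + ((a * h $ 2 - b * h $ 1)\<^sup>2 + (c * h $ 2 - d * h $ 1)\<^sup>2)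
     = (a\<^sup>2 + b\<^sup>2 + c\<^sup>2 + d\<^sup>2) * ((h $ 1)\<^sup>2 + (h $ 2)\<^sup>2)"
    by (simp add: power2_eq_square algebra_simps)
  then have "(a * h $ 1 + b * h $ 2)\<^sup>2 + (c * h $ 1 + d * h $ 2)\<^sup>2 \<le> (a\<^sup>2 + b\<^sup>2 + c\<^sup>2 + d\<^sup>2) * ((h $ 1)\<^sup>2 + (h $ 2)\<^sup>2)"
    by (smt (verit) zero_le_power2)
  then show "norm (?M *v h) \<le> sqrt (a\<^sup>2 + b\<^sup>2 + c\<^sup>2 + d\<^sup>2) * norm h"
    unfolding norm_vec2[of "?M *v h"] norm_vec2[of h] Mv real_sqrt_mult[symmetric] by (rule real_sqrt_le_mono)
qed

text \<open>Multiplication by the conjugate of \<open>w\<close> turns the pair of gradients \<open>p\<close>, \<open>q\<close> into a pair \<open>P\<close>, \<open>Q\<close>, multiplying both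
  the sum of squares and the determinant by \<open>|w|\<^sup>2\<close>.  With \<open>X\<^sup>2 = |P|\<^sup>2 + |Q|\<^sup>2\<close> the hypothesis gives
  \<open>X\<^sup>2 \<le> k |P| |Q| \<le> k |P| X\<close>, hence \<open>X \<le> k |P|\<close>.\<close>

lemma gradient_comparison:
  fixes w p q :: complex
  assumes F: "(norm p)\<^sup>2 + (norm q)\<^sup>2 \<le> k * \<bar>Re p * Im q - Im p * Re q\<bar>" and k: "0 \<le> k"
  shows "(norm w)\<^sup>2 * ((norm p)\<^sup>2 + (norm q)\<^sup>2) \<le> k\<^sup>2 * (norm (Re w *\<^sub>R p + Im w *\<^sub>R q))\<^sup>2"
proof -
  define P where "P = Re w *\<^sub>R p + Im w *\<^sub>R q"
  define Q where "Q = Re w *\<^sub>R q - Im w *\<^sub>R p"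
  define X where "X = sqrt ((norm P)\<^sup>2 + (norm Q)\<^sup>2)"
  have X2: "X\<^sup>2 = (norm w)\<^sup>2 * ((norm p)\<^sup>2 + (norm q)\<^sup>2)"
    unfolding X_def by (simp add: P_def Q_def cmod_power2[of "_ + _"] cmod_power2[of "_ - _"] cmod_power2[of w] cmod_power2[of p] cmod_power2[of q])
      (simp add: power2_eq_square algebra_simps)
  have "X\<^sup>2 \<le> (norm w)\<^sup>2 * (k * \<bar>Re p * Im q - Im p * Re q\<bar>)"
    unfolding X2 using F by (intro mult_left_mono) auto
  also have "\<dots> = k * \<bar>(norm w)\<^sup>2 * (Re p * Im q - Im p * Re q)\<bar>" by (simp add: abs_mult)
  also have "(norm w)\<^sup>2 * (Re p * Im q - Im p * Re q) = Im (cnj P * Q)"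
    unfolding cmod_power2 P_def Q_def by (simp add: power2_eq_square algebra_simps)
  also have "k * \<bar>Im (cnj P * Q)\<bar> \<le> k * (norm P * norm Q)"
    using k abs_Im_le_cmod[of "cnj P * Q"] by (intro mult_left_mono) (auto simp: norm_mult)
  also have "norm Q \<le> X" unfolding X_def by (rule real_le_rsqrt) simp
  then have "k * (norm P * norm Q) \<le> k * (norm P * X)" using k by (intro mult_left_mono) auto
  finally have *: "X * X \<le> k * norm P * X" by (simp add: power2_eq_square mult_ac)
  have X0: "0 \<le> X" by (simp add: X_def)
  have "X \<le> k * norm P"
  proof (cases "X = 0")
    case False
    then show ?thesis using * X0 by simp
  qed (use k in simp)
  then have "X\<^sup>2 \<le> (k * norm P)\<^sup>2" using X0 by (intro power_mono) auto
  then show ?thesis unfolding X2 P_def[symmetric] by (simp add: power_mult_distrib)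
qed

lemma has_jet2_normsq:
  assumes u: "has_jet2 u p au bu cu z" and v: "has_jet2 v q av bv cv z"
  shows "has_jet2 (\<lambda>z. (u z)\<^sup>2 + (v z)\<^sup>2) (2 *\<^sub>R (u z *\<^sub>R p + v z *\<^sub>R q))
    (2 * ((Re p)\<^sup>2 + (Re q)\<^sup>2 + u z * au + v z * av))
    (2 * (Re p * Im p + Re q * Im q + u z * bu + v z * bv))
    (2 * ((Im p)\<^sup>2 + (Im q)\<^sup>2 + u z * cu + v z * cv)) z"
  unfolding has_jet2_def
proof
  fix \<xi> :: complex
  let ?u = "\<lambda>t. u (z + t *\<^sub>R \<xi>)" and ?v = "\<lambda>t. v (z + t *\<^sub>R \<xi>)"
  have "deriv2 ?u (p \<bullet> \<xi>) (qf au bu cu \<xi>)" "deriv2 ?v (q \<bullet> \<xi>) (qf av bv cv \<xi>)"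
    using u v unfolding has_jet2_def by auto
  from deriv2_add[OF deriv2_mult[OF this(1) this(1)] deriv2_mult[OF this(2) this(2)]]
  have "deriv2 (\<lambda>t. (u (z + t *\<^sub>R \<xi>))\<^sup>2 + (v (z + t *\<^sub>R \<xi>))\<^sup>2)
    (2 * (u z * (p \<bullet> \<xi>) + v z * (q \<bullet> \<xi>)))
    (2 * ((p \<bullet> \<xi>)\<^sup>2 + u z * qf au bu cu \<xi> + ((q \<bullet> \<xi>)\<^sup>2 + v z * qf av bv cv \<xi>)))"
    by (simp add: power2_eq_square algebra_simps)
  moreover have "2 * (u z * (p \<bullet> \<xi>) + v z * (q \<bullet> \<xi>)) = (2 *\<^sub>R (u z *\<^sub>R p + v z *\<^sub>R q)) \<bullet> \<xi>"
    by (simp add: inner_add_left)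
  moreover have "2 * ((p \<bullet> \<xi>)\<^sup>2 + u z * qf au bu cu \<xi> + ((q \<bullet> \<xi>)\<^sup>2 + v z * qf av bv cv \<xi>)) =
    qf (2 * ((Re p)\<^sup>2 + (Re q)\<^sup>2 + u z * au + v z * av))
    (2 * (Re p * Im p + Re q * Im q + u z * bu + v z * bv))
    (2 * ((Im p)\<^sup>2 + (Im q)\<^sup>2 + u z * cu + v z * cv)) \<xi>"
    by (simp add: power2_eq_square qf_def inner_complex_def algebra_simps)
  ultimately show "deriv2 (\<lambda>t. (u (z + t *\<^sub>R \<xi>))\<^sup>2 + (v (z + t *\<^sub>R \<xi>))\<^sup>2) ((2 *\<^sub>R (u z *\<^sub>R p + v z *\<^sub>R q)) \<bullet> \<xi>)
    (qf (2 * ((Re p)\<^sup>2 + (Re q)\<^sup>2 + u z * au + v z * av))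
    (2 * (Re p * Im p + Re q * Im q + u z * bu + v z * bv))
    (2 * ((Im p)\<^sup>2 + (Im q)\<^sup>2 + u z * cu + v z * cv)) \<xi>)"
    by simp
qed

section \<open>A barrier at the unit circle\<close>

text \<open>With \<open>m = \<Lambda> B + 1\<close> the last factor is the multiple of \<open>1 - |z|\<^sup>2\<close> that dominates
  \<open>exp (- m s) - exp (- m)\<close>; the first factor passes from this difference to \<open>1 - s\<close>.\<close>

definition barrier_const :: "real \<Rightarrow> real \<Rightarrow> real \<Rightarrow> real \<Rightarrow> real" where
  "barrier_const \<Lambda> B \<Gamma> r =
     exp (\<Lambda> * B + 1) / (\<Lambda> * B + 1) * (1 / (1 - r\<^sup>2) + \<Lambda> * (\<Lambda> * B + 1) * \<Gamma> / 4 + 1)"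

text \<open>Put \<open>Q = exp (- m s) - exp (- m) - M (1 - |z|\<^sup>2)\<close>.  The exponential contributes \<open>m\<^sup>2 \<langle>A \<nabla>s, \<nabla>s\<rangle>\<close> to
  \<open>L Q\<close>, up to the factor \<open>exp (- m s)\<close>, which absorbs the term quadratic in the gradient, and the
  contribution of \<open>M |z|\<^sup>2\<close> outweighs the rest; so \<open>L Q > 0\<close> wherever \<open>s \<ge> 1/4\<close>.  A positive maximum of \<open>Q\<close> would lie there, because
  \<open>Q \<le> 0\<close> in the disc of radius \<open>r0\<close> that contains \<open>{s \<le> 1/4}\<close>, and it would be attained,
  because a compact sublevel set of \<open>s\<close> contains all points at which \<open>Q\<close> exceeds a given positive value.\<close>

lemma boundary_barrier:
  fixes \<Lambda> B \<Gamma> r0 :: real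
  assumes "1 \<le> \<Lambda>" "0 \<le> B" "0 \<le> \<Gamma>" "0 \<le> r0" "r0 < 1"
    and ell: "\<And>z \<xi>. z \<in> ball 0 1 \<Longrightarrow> (norm \<xi>)\<^sup>2 / \<Lambda> \<le> qf (\<alpha> z) (\<beta> z) (\<gamma> z) \<xi>"
    and jet: "\<And>z. z \<in> ball 0 1 \<Longrightarrow> has_jet2 s (p z) (a z) (b z) (c z) z"
    and eqn: "\<And>z. z \<in> ball 0 1 \<Longrightarrow> 1/4 \<le> s z \<Longrightarrow>
      \<bar>\<alpha> z * a z + 2 * \<beta> z * b z + \<gamma> z * c z\<bar> \<le> B * (norm (p z))\<^sup>2 + \<Gamma>"
    and cont: "continuous_on (ball 0 1) s"
    and range: "\<And>z. z \<in> ball 0 1 \<Longrightarrow> 0 \<le> s z \<and> s z < 1"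
    and proper: "\<And>d. d < 1 \<Longrightarrow> compact {z \<in> ball 0 1. s z \<le> d}"
    and inner: "\<And>z. z \<in> ball 0 1 \<Longrightarrow> s z \<le> 1/4 \<Longrightarrow> norm z \<le> r0"
    and z: "z \<in> ball 0 1"
  shows "1 - s z \<le> barrier_const \<Lambda> B \<Gamma> r0 * (1 - (norm z)\<^sup>2)"
proof -
  define m where "m = \<Lambda> * B + 1"
  define M where "M = 1 / (1 - r0\<^sup>2) + \<Lambda> * m * \<Gamma> / 4 + 1"
  have m: "1 \<le> m" using assms(1,2) by (simp add: m_def)
  have r1: "r0\<^sup>2 < 1" using assms(4,5) by (simp add: power_less_one_iff abs_square_less_1)
  have M0: "0 < M" "1 / (1 - r0\<^sup>2) \<le> M" "\<Lambda> * m * \<Gamma> / 4 < M"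
    using r1 assms(1,3) m unfolding M_def by (auto intro!: add_nonneg_pos add_nonneg_nonneg simp: add_pos_nonneg)
  define \<psi> where "\<psi> = (\<lambda>z. exp (- m * s z) - exp (- m))"
  define Q where "Q = (\<lambda>z. \<psi> z + M * (norm z)\<^sup>2 - M)"
  have low: "Q z \<le> 0" if "z \<in> ball 0 1" "s z \<le> 1/4" for z
  proof -
    have "(norm z)\<^sup>2 \<le> r0\<^sup>2" using inner[OF that] by (intro power_mono) auto
    then have "M * (norm z)\<^sup>2 \<le> M * r0\<^sup>2" using M0 by (intro mult_left_mono) auto
    moreover have "1 \<le> M * (1 - r0\<^sup>2)" using M0 r1 by (simp add: field_simps)
    moreover have "exp (- m * s z) \<le> 1" using range[OF that(1)] m by simp
    ultimately show ?thesis using exp_gt_zero[of "- m"] unfolding Q_def \<psi>_def right_diff_distrib by linarith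
  qed
  have "Q z \<le> 0"
  proof (rule ccontr)
    assume "\<not> Q z \<le> 0"
    then have dz: "0 < Q z" by simp
    define \<delta> where "\<delta> = Q z"
    \<comment> \<open>The value of \<open>s\<close> at which \<open>exp (- m s) - exp (- m)\<close> equals \<open>\<delta>\<close>.\<close>
    define d where "d = - ln (exp (- m) + \<delta>) / m"
    have dpos: "0 < exp (- m) + \<delta>" using dz by (simp add: \<delta>_def add_pos_pos)
    have iff: "\<delta> \<le> \<psi> x \<longleftrightarrow> s x \<le> d" for x
    proof -
      have "\<delta> \<le> \<psi> x \<longleftrightarrow> exp (ln (exp (- m) + \<delta>)) \<le> exp (- m * s x)"
        using dpos by (auto simp: \<psi>_def)
      also have "\<dots> \<longleftrightarrow> s x \<le> d" unfolding exp_le_cancel_iff d_def pos_le_divide_eq[OF less_le_trans[OF zero_less_one m]]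
        by (simp only: mult.commute[of "s x"]) linarith
      finally show ?thesis .
    qed
    have "ln (exp (- m)) < ln (exp (- m) + \<delta>)"
      using dz dpos by (subst ln_less_cancel_iff) (simp_all add: \<delta>_def)
    then have "- m < ln (exp (- m) + \<delta>)" by (simp only: ln_exp)
    then have d1: "d < 1" using m by (simp add: d_def field_simps)
    have Qchi: "Q x \<le> \<psi> x" if "x \<in> ball 0 1" for x
    proof -
      have "M * (norm x)\<^sup>2 \<le> M * 1" using that M0 by (intro mult_left_mono) (auto simp: power_le_one)
      then show ?thesis by (simp add: Q_def)
    qed
    define T where "T = {z \<in> ball 0 1. s z \<le> d}"
    have T: "compact T" unfolding T_def by (rule proper[OF d1])
    have zT: "z \<in> T" using z Qchi[OF z] iff[of z] by (simp add: T_def \<delta>_def)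
    have "continuous_on T Q" unfolding Q_def \<psi>_def T_def
      by (intro continuous_intros continuous_on_subset[OF cont]) auto
    with T zT obtain x where x: "x \<in> T" "\<And>y. y \<in> T \<Longrightarrow> Q y \<le> Q x"
      using continuous_attains_sup[of T Q] by blast
    have xb: "x \<in> ball 0 1" using x by (simp add: T_def)
    have glob: "Q y \<le> Q x" if y: "y \<in> ball 0 1" for y
    proof (cases "y \<in> T")
      case False
      then have "\<psi> y < \<delta>" using y iff[of y] by (auto simp: T_def)
      then show ?thesis using Qchi[OF y] x(2)[OF zT] by (simp add: \<delta>_def)
    qed (use x in auto)
    have "0 < Q x" using x(2)[OF zT] dz by simp
    then have sx: "1/4 \<le> s x" using low[OF xb] by force
    define E where "E = exp (- m * s x)"
    have E: "0 < E" "E \<le> 1" using range[OF xb] m by (auto simp: E_def)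
    have "\<alpha> x * (m\<^sup>2 * E * (Re (p x))\<^sup>2 - m * E * a x + 2 * M)
        + 2 * \<beta> x * (m\<^sup>2 * E * (Re (p x) * Im (p x)) - m * E * b x)
        + \<gamma> x * (m\<^sup>2 * E * (Im (p x))\<^sup>2 - m * E * c x + 2 * M) \<le> 0"
    proof (rule trace_nonpos)
      fix \<xi> :: complex
      show "0 \<le> qf (\<alpha> x) (\<beta> x) (\<gamma> x) \<xi>" using ell[OF xb, of \<xi>] assms(1) by (smt (verit) divide_nonneg_pos zero_le_power2)
      define g where "g = (\<lambda>t. exp (- m * s (x + t *\<^sub>R \<xi>)) + (M * (norm x)\<^sup>2 - M - exp (- m) + (2 * M * (x \<bullet> \<xi>)) * t + (M * (norm \<xi>)\<^sup>2) * t\<^sup>2))"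
      have "deriv2 (\<lambda>t. s (x + t *\<^sub>R \<xi>)) (p x \<bullet> \<xi>) (qf (a x) (b x) (c x) \<xi>)"
        using jet[OF xb] unfolding has_jet2_def by blast
      moreover have "((\<lambda>y. exp (- m * y)) has_real_derivative - m * exp (- m * y)) (at y)" for y
        by (auto intro!: derivative_eq_intros)
      moreover have "((\<lambda>y. - m * exp (- m * y)) has_real_derivative m\<^sup>2 * E) (at (s (x + 0 *\<^sub>R \<xi>)))"
        by (auto intro!: derivative_eq_intros simp: E_def power2_eq_square)
      ultimately have "deriv2 (\<lambda>t. exp (- m * s (x + t *\<^sub>R \<xi>))) (- m * exp (- m * s (x + 0 *\<^sub>R \<xi>)) * (p x \<bullet> \<xi>))
          (m\<^sup>2 * E * (p x \<bullet> \<xi>)\<^sup>2 + - m * exp (- m * s (x + 0 *\<^sub>R \<xi>)) * qf (a x) (b x) (c x) \<xi>)"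
        by (rule deriv2_compose)
      then have "deriv2 (\<lambda>t. exp (- m * s (x + t *\<^sub>R \<xi>))) (- m * E * (p x \<bullet> \<xi>)) (m\<^sup>2 * E * (p x \<bullet> \<xi>)\<^sup>2 + - m * E * qf (a x) (b x) (c x) \<xi>)"
        by (simp add: E_def)
      from deriv2_add[OF this deriv2_quadratic]
      have "deriv2 g (- m * E * (p x \<bullet> \<xi>) + 2 * M * (x \<bullet> \<xi>)) (m\<^sup>2 * E * (p x \<bullet> \<xi>)\<^sup>2 + - m * E * qf (a x) (b x) (c x) \<xi> + 2 * (M * (norm \<xi>)\<^sup>2))"
        unfolding g_def by blast
      moreover have "\<forall>\<^sub>F t in nhds 0. g t \<le> g 0"
      proof -
        have "((\<lambda>t. x + t *\<^sub>R \<xi>) \<longlongrightarrow> x + 0 *\<^sub>R \<xi>) (nhds (0::real))"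
          by (intro tendsto_intros filterlim_ident)
        then have "\<forall>\<^sub>F t in nhds (0::real). x + t *\<^sub>R \<xi> \<in> ball 0 1"
          using xb by (auto dest!: topological_tendstoD[of _ _ _ "ball 0 1"])
        then show ?thesis
        proof eventually_elim
          case (elim t)
          have "g t = Q (x + t *\<^sub>R \<xi>)" for t
            unfolding g_def Q_def \<psi>_def norm_sq_complex_line by (simp add: algebra_simps)
          from this[of t] this[of 0] glob[OF elim] show ?case by simp
        qed
      qed
      ultimately have "m\<^sup>2 * E * (p x \<bullet> \<xi>)\<^sup>2 + - m * E * qf (a x) (b x) (c x) \<xi> + 2 * (M * (norm \<xi>)\<^sup>2) \<le> 0"
        using deriv2_local_max(2) by blast
      also have "m\<^sup>2 * E * (p x \<bullet> \<xi>)\<^sup>2 + - m * E * qf (a x) (b x) (c x) \<xi> + 2 * (M * (norm \<xi>)\<^sup>2) =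
         qf (m\<^sup>2 * E * (Re (p x))\<^sup>2 - m * E * a x + 2 * M) (m\<^sup>2 * E * (Re (p x) * Im (p x)) - m * E * b x)
           (m\<^sup>2 * E * (Im (p x))\<^sup>2 - m * E * c x + 2 * M) \<xi>"
        unfolding cmod_power2 inner_complex_def by (simp add: qf_def power2_eq_square algebra_simps)
      finally show "\<dots> \<le> 0" .
    qed
    also have "\<alpha> x * (m\<^sup>2 * E * (Re (p x))\<^sup>2 - m * E * a x + 2 * M)
        + 2 * \<beta> x * (m\<^sup>2 * E * (Re (p x) * Im (p x)) - m * E * b x)
        + \<gamma> x * (m\<^sup>2 * E * (Im (p x))\<^sup>2 - m * E * c x + 2 * M) =
        m * E * (m * qf (\<alpha> x) (\<beta> x) (\<gamma> x) (p x) - (\<alpha> x * a x + 2 * \<beta> x * b x + \<gamma> x * c x)) + 2 * M * (\<alpha> x + \<gamma> x)"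
      by (simp add: qf_def power2_eq_square algebra_simps)
    finally have neg: "\<dots> \<le> 0" .
    have "B * (norm (p x))\<^sup>2 \<le> m * qf (\<alpha> x) (\<beta> x) (\<gamma> x) (p x)"
    proof -
      have "B \<le> m / \<Lambda>" using assms(1) by (simp add: m_def field_simps)
      then have "B * (norm (p x))\<^sup>2 \<le> m / \<Lambda> * (norm (p x))\<^sup>2" by (rule mult_right_mono) simp
      also have "\<dots> = m * ((norm (p x))\<^sup>2 / \<Lambda>)" by simp
      also have "\<dots> \<le> m * qf (\<alpha> x) (\<beta> x) (\<gamma> x) (p x)" using m ell[OF xb, of "p x"] by (intro mult_left_mono) auto
      finally show ?thesis .
    qed
    then have "- \<Gamma> \<le> m * qf (\<alpha> x) (\<beta> x) (\<gamma> x) (p x) - (\<alpha> x * a x + 2 * \<beta> x * b x + \<gamma> x * c x)"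
      using eqn[OF xb sx] by (simp add: abs_le_iff)
    then have "m * E * (- \<Gamma>) \<le> m * E * (m * qf (\<alpha> x) (\<beta> x) (\<gamma> x) (p x) - (\<alpha> x * a x + 2 * \<beta> x * b x + \<gamma> x * c x))"
      using m E by (intro mult_left_mono) auto
    moreover have "m * E * \<Gamma> \<le> m * 1 * \<Gamma>" using m E assms(3) by (intro mult_right_mono mult_left_mono) auto
    moreover have "m * \<Gamma> < 4 * M / \<Lambda>" using M0(3) assms(1) by (simp add: field_simps)
    moreover have "2 * M * (2 / \<Lambda>) \<le> 2 * M * (\<alpha> x + \<gamma> x)"
      using M0 ell[OF xb, of 1] ell[OF xb, of \<i>] by (intro mult_left_mono) (auto simp: qf_def)
    ultimately show False using neg by simp
  qed
  then have "\<psi> z \<le> M * (1 - (norm z)\<^sup>2)" by (simp add: Q_def algebra_simps)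
  moreover have "m * exp (- m) * (1 - s z) \<le> \<psi> z"
  proof -
    have "exp (- m) * (1 + m * (1 - s z)) \<le> exp (- m) * exp (m * (1 - s z))"
      using exp_ge_add_one_self[of "m * (1 - s z)"] by (intro mult_left_mono) auto
    also have "\<dots> = exp (- m * s z)" by (simp add: exp_add[symmetric] algebra_simps)
    finally show ?thesis by (simp add: \<psi>_def algebra_simps)
  qed
  ultimately have "m * exp (- m) * (1 - s z) \<le> M * (1 - (norm z)\<^sup>2)" by simp
  then have "(exp m / m) * (m * exp (- m) * (1 - s z)) \<le> (exp m / m) * (M * (1 - (norm z)\<^sup>2))"
    using m by (intro mult_left_mono) auto
  moreover have "(exp m / m) * (m * exp (- m) * (1 - s z)) = 1 - s z" using m by (simp add: exp_minus field_simps)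
  moreover have "barrier_const \<Lambda> B \<Gamma> r0 = exp m / m * M" by (simp add: barrier_const_def m_def M_def)
  ultimately show ?thesis by (simp only: mult.assoc)
qed

section \<open>The length-area method\<close>

text \<open>The change of variables theorem lives on \<open>\<real>\<^sup>2\<close> as a type of vectors, iterated integrals on the
  product \<open>\<real> \<times> \<real>\<close>; this lemma connects the two.\<close>

lemma has_integral_real2_pair:
  fixes f :: "real \<times> real \<Rightarrow> real"
  assumes "(f has_integral i) (cbox (a, c) (b, d))"
  shows "((\<lambda>v::real^2. f (v $ 1, v $ 2)) has_integral i) (cbox (vector [a, c]) (vector [b, d]))"
proof -
  let ?g = "\<lambda>v::real^2. (v $ 1, v $ 2)" and ?h = "\<lambda>p. vector [fst p, snd p] :: real^2"
  have hg: "?h (?g x) = x" for x by (simp add: vec_eq_iff forall_2 vector_2)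
  have gh: "?g (?h x) = x" for x by (simp add: vector_2)
  have gim: "?g ` cbox u v = cbox (u $ 1, u $ 2) (v $ 1, v $ 2)" for u v
  proof -
    have "x \<in> ?g ` cbox u v \<longleftrightarrow> ?h x \<in> cbox u v" for x
      using hg gh by (metis (no_types, lifting) image_iff)
    then show ?thesis by (auto simp: mem_box_cart forall_2 vector_2 cbox_Pair_eq)
  qed
  have him: "?h ` cbox u v = cbox (?h u) (?h v)" for u v
  proof -
    have "?h ` cbox u v = ?h ` (?g ` cbox (?h u) (?h v))" by (simp add: gim vector_2)
    then show ?thesis unfolding image_image hg by simp
  qed
  have "((\<lambda>x. f (?g x)) has_integral (1 / 1) *\<^sub>R i) (?h ` cbox (a, c) (b, d))"
  proof (rule has_integral_twiddle[OF _ hg gh _ _ _ _ assms])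
    show "continuous (at x) ?g" for x by (intro continuous_intros)
    show "\<exists>w z. ?g ` cbox u v = cbox w z" "\<exists>w z. ?h ` cbox u' v' = cbox w z" for u v u' v'
      using gim him by blast+
    show "measure lborel (?g ` cbox u v) = 1 * measure lborel (cbox u v)" for u v
    proof (cases "cbox u v = {}")
      case False
      then have "u $ 1 \<le> v $ 1" "u $ 2 \<le> v $ 2" by (auto simp: interval_ne_empty_cart)
      with False show ?thesis
        unfolding gim content_Pair by (simp add: content_cbox_cart UNIV_2)
    qed simp
  qed simp
  then show ?thesis unfolding him by simp
qed

text \<open>The left-hand side is the area of the image of the rectangle, which lies in the unit disc.\<close>

lemma jacobian_integral_le:
  fixes W W1 W2 :: "complex \<Rightarrow> complex"
  assumes der: "\<And>\<zeta>. \<zeta> \<in> cbox (Complex a c) (Complex b d) \<Longrightarrow>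
      (W has_derivative (\<lambda>h. Re h *\<^sub>R W1 \<zeta> + Im h *\<^sub>R W2 \<zeta>)) (at \<zeta>)"
    and cont: "continuous_on (cbox (Complex a c) (Complex b d)) W1" "continuous_on (cbox (Complex a c) (Complex b d)) W2"
    and inj: "inj_on W (cbox (Complex a c) (Complex b d))"
    and im: "W ` cbox (Complex a c) (Complex b d) \<subseteq> ball 0 1"
  shows "integral (cbox (a, c) (b, d)) (\<lambda>(s, t). \<bar>Im (cnj (W1 (Complex s t)) * W2 (Complex s t))\<bar>)
     \<le> measure lebesgue (ball (0 :: real^2) 1)"
proof -
  define vec2 where "vec2 = (\<lambda>z. vector [Re z, Im z] :: real^2)"
  define cpl where "cpl = (\<lambda>v::real^2. Complex (v $ 1) (v $ 2))"
  have vec2: "bounded_linear vec2"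
    by (rule bounded_linear_intro[where K = 1])
      (auto simp: vec2_def vec_eq_iff forall_2 vector_2 norm_vec2 cmod_def)
  have cpl: "bounded_linear cpl"
    by (rule bounded_linear_intro[where K = 1])
      (auto simp: cpl_def complex_eq_iff norm_vec2 cmod_def)
  have vi: "inj vec2" by (auto simp: inj_def vec2_def vec_eq_iff forall_2 vector_2 complex_eq_iff)
  have ci: "inj cpl" by (auto simp: inj_def cpl_def vec_eq_iff forall_2)
  define R where "R = cbox (vector [a, c]) (vector [b, d] :: real^2)"
  have Rc: "cpl v \<in> cbox (Complex a c) (Complex b d)" if "v \<in> R" for v
    using that unfolding R_def by (auto simp: cpl_def mem_box_cart forall_2 vector_2 in_cbox_complex_iff)
  define G where "G = (\<lambda>v. vec2 (W (cpl v)))"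
  define G' where "G' = (\<lambda>v h. vec2 (Re (cpl h) *\<^sub>R W1 (cpl v) + Im (cpl h) *\<^sub>R W2 (cpl v)))"
  have dG: "(G has_derivative G' v) (at v within R)" if "v \<in> R" for v
  proof -
    from has_derivative_compose[OF bounded_linear_imp_has_derivative[OF cpl] der[OF Rc[OF that]]]
    have "((\<lambda>v. W (cpl v)) has_derivative (\<lambda>h. Re (cpl h) *\<^sub>R W1 (cpl v) + Im (cpl h) *\<^sub>R W2 (cpl v))) (at v within R)" .
    from bounded_linear.has_derivative[OF vec2 this] show ?thesis
      unfolding G_def G'_def .
  qed
  have iG: "inj_on G R"
  proof (rule inj_onI)
    fix x y assume "x \<in> R" "y \<in> R" "G x = G y"
    then have "W (cpl x) = W (cpl y)" using vi by (auto simp: G_def inj_def)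
    then have "cpl x = cpl y" using inj Rc \<open>x \<in> R\<close> \<open>y \<in> R\<close> by (auto dest: inj_onD)
    then show "x = y" using ci by (auto simp: inj_def)
  qed
  have "continuous_on R G"
    using dG by (auto intro: has_derivative_continuous simp: continuous_on_eq_continuous_within)
  then have "compact (G ` R)" unfolding R_def by (intro compact_continuous_image) auto
  then have GR: "G ` R \<in> lmeasurable" by (rule lmeasurable_compact)
  have sub: "G ` R \<subseteq> ball 0 1"
  proof
    fix y assume "y \<in> G ` R"
    then obtain v where "v \<in> R" "y = vec2 (W (cpl v))" by (auto simp: G_def)
    moreover from this have "W (cpl v) \<in> ball 0 1" using im Rc by blast
    moreover have "norm (vec2 z) = norm z" for z by (simp add: vec2_def norm_vec2 vector_2 cmod_def)
    ultimately show "y \<in> ball 0 1" by simp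
  qed
  have "((\<lambda>x. \<bar>det (matrix (G' x))\<bar>) has_integral (measure lebesgue (G ` R))) R"
    using has_measure_differentiable_image[OF _ dG iG] GR by (auto simp: R_def)
  moreover have "det (matrix (G' v)) = Im (cnj (W1 (cpl v)) * W2 (cpl v))" for v
    by (simp add: det_2 matrix_def G'_def cpl_def vec2_def vector_2 axis_def algebra_simps)
  ultimately have 1: "((\<lambda>v. \<bar>Im (cnj (W1 (cpl v)) * W2 (cpl v))\<bar>) has_integral (measure lebesgue (G ` R))) R"
    by simp
  let ?j = "\<lambda>(s, t). \<bar>Im (cnj (W1 (Complex s t)) * W2 (Complex s t))\<bar>"
  have cR: "continuous_on (cbox (a, c) (b, d)) (\<lambda>p. V (Complex (fst p) (snd p)))"
    if "continuous_on (cbox (Complex a c) (Complex b d)) V" for V :: "complex \<Rightarrow> complex"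
    by (rule continuous_on_compose2[OF that])
      (auto simp: cbox_Pair_eq in_cbox_complex_iff intro!: continuous_on_Complex continuous_on_fst continuous_on_snd continuous_on_id)
  have "continuous_on (cbox (a, c) (b, d)) ?j"
    unfolding split_beta' by (intro continuous_intros cR cont)
  then have "(?j has_integral integral (cbox (a, c) (b, d)) ?j) (cbox (a, c) (b, d))"
    by (intro integrable_integral integrable_continuous)
  from has_integral_real2_pair[OF this] 1
  have "integral (cbox (a, c) (b, d)) ?j = measure lebesgue (G ` R)"
    unfolding R_def cpl_def by (simp add: has_integral_unique)
  also have "\<dots> \<le> measure lebesgue (ball (0 :: real^2) 1)"
    by (rule measure_mono_fmeasurable[OF sub]) (use GR in auto)
  finally show ?thesis .
qed

text \<open>Each vertical segment contains a piece whose image has length at least \<open>1/4\<close>.  With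
  \<open>x \<le> 8 x\<^sup>2 + 1/32\<close> in the role of the Cauchy-Schwarz inequality, and since the height \<open>2 T\<close> is at
  most \<open>4\<close>, the integral of \<open>|W2|\<^sup>2\<close> over the segment is at least \<open>1/64\<close>.  Integrating over \<open>s\<close>, the total is at
  most \<open>k\<close> times the area of the image.\<close>

lemma length_area:
  fixes W W1 W2 :: "complex \<Rightarrow> complex"
  assumes der: "\<And>\<zeta>. \<zeta> \<in> cbox (Complex a (-T)) (Complex b T) \<Longrightarrow>
      (W has_derivative (\<lambda>h. Re h *\<^sub>R W1 \<zeta> + Im h *\<^sub>R W2 \<zeta>)) (at \<zeta>)"
    and cont: "continuous_on (cbox (Complex a (-T)) (Complex b T)) W1" "continuous_on (cbox (Complex a (-T)) (Complex b T)) W2"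
    and inj: "inj_on W (cbox (Complex a (-T)) (Complex b T))"
    and im: "W ` cbox (Complex a (-T)) (Complex b T) \<subseteq> ball 0 1"
    and qc: "\<And>\<zeta>. \<zeta> \<in> cbox (Complex a (-T)) (Complex b T) \<Longrightarrow> (norm (W2 \<zeta>))\<^sup>2 \<le> k * \<bar>Im (cnj (W1 \<zeta>) * W2 \<zeta>)\<bar>"
    and k: "0 \<le> k" and T: "0 \<le> T" "T \<le> 2" and ab: "a \<le> b"
    and cross: "\<And>s. a \<le> s \<Longrightarrow> s \<le> b \<Longrightarrow> \<exists>t. \<bar>t\<bar> \<le> T \<and> 1 / 4 \<le> norm (W (Complex s T) - W (Complex s t))"
  shows "b - a \<le> 64 * k * measure lebesgue (ball (0 :: real^2) 1)"
proof -
  define j where "j = (\<lambda>(s, t). \<bar>Im (cnj (W1 (Complex s t)) * W2 (Complex s t))\<bar>)"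
  have cR: "continuous_on (cbox (a, -T) (b, T)) (\<lambda>p. V (Complex (fst p) (snd p)))"
    if "continuous_on (cbox (Complex a (-T)) (Complex b T)) V" for V :: "complex \<Rightarrow> complex"
    by (rule continuous_on_compose2[OF that])
      (auto simp: cbox_Pair_eq in_cbox_complex_iff intro!: continuous_on_Complex continuous_on_fst continuous_on_snd continuous_on_id)
  have cj: "continuous_on (cbox (a, -T) (b, T)) j"
    unfolding j_def split_beta' by (intro continuous_intros cR cont)
  have slice: "1 / 64 \<le> k * integral {-T..T} (\<lambda>t. j (s, t))" if s: "s \<in> {a..b}" for s
  proof -
    have inR: "Complex s t \<in> cbox (Complex a (-T)) (Complex b T)" if "t \<in> {-T..T}" for t
      using s that by (auto simp: in_cbox_complex_iff)
    have cs: "continuous_on {-T..T} (\<lambda>t. V (Complex s t))"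
      if "continuous_on (cbox (Complex a (-T)) (Complex b T)) V" for V :: "complex \<Rightarrow> complex"
      by (rule continuous_on_compose2[OF that])
        (auto intro!: inR continuous_on_Complex continuous_on_id continuous_on_const simp del: Complex_eq)
    have cjs: "continuous_on {-T..T} (\<lambda>t. j (s, t))"
      unfolding j_def split_beta' fst_conv snd_conv by (intro continuous_intros cs cont)
    obtain t where t: "\<bar>t\<bar> \<le> T" "1 / 4 \<le> norm (W (Complex s T) - W (Complex s t))" using cross s by auto
    let ?n = "\<lambda>t. W2 (Complex s t)"
    let ?q = "\<lambda>t. 8 * (norm (?n t))\<^sup>2 + 1 / 32"
    have cq: "continuous_on {-T..T} ?q" by (intro continuous_intros cs cont)
    have "(?n has_integral (W (Complex s T) - W (Complex s t))) {t..T}"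
    proof (rule fundamental_theorem_of_calculus)
      fix x assume x: "x \<in> {t..T}"
      have "((\<lambda>x. Complex s x) has_derivative (\<lambda>h. Complex 0 h)) (at x within {t..T})"
      proof -
        have "((\<lambda>x. Complex s 0 + x *\<^sub>R \<i>) has_derivative (\<lambda>h. h *\<^sub>R \<i>)) (at x within {t..T})"
          by (auto intro!: derivative_eq_intros)
        moreover have "(\<lambda>x. Complex s 0 + x *\<^sub>R \<i>) = (\<lambda>x. Complex s x)" "(\<lambda>h. h *\<^sub>R \<i>) = (\<lambda>h. Complex 0 h)"
          by (auto simp: complex_eq_iff)
        ultimately show ?thesis by simp
      qed
      from has_derivative_compose[OF this der[OF inR]] x t
      show "((\<lambda>x. W (Complex s x)) has_vector_derivative ?n x) (at x within {t..T})"
        by (simp add: has_vector_derivative_def abs_le_iff)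
    qed (use t in auto)
    then have "W (Complex s T) - W (Complex s t) = integral {t..T} ?n" by (simp add: has_integral_iff)
    then have "1 / 4 \<le> norm (integral {t..T} ?n)" using t by simp
    also have "\<dots> \<le> integral {t..T} ?q"
    proof (rule integral_norm_bound_integral)
      have "{t..T} \<subseteq> {-T..T}" using t by auto
      then show "?n integrable_on {t..T}" "?q integrable_on {t..T}"
        by (auto intro!: integrable_continuous_real continuous_on_subset[OF cq] continuous_on_subset[OF cs[OF cont(2)]])
      fix x
      have "0 \<le> 8 * (norm (?n x) - 1 / 16)\<^sup>2" by simp
      then show "norm (?n x) \<le> ?q x" by (simp add: power2_eq_square algebra_simps)
    qed
    also have "\<dots> \<le> integral {-T..T} ?q"
      using t by (intro integral_subset_le integrable_continuous_real continuous_on_subset[OF cq]) auto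
    also have "\<dots> \<le> integral {-T..T} (\<lambda>t. 8 * (k * j (s, t)) + 1 / 32)"
    proof (rule integral_le)
      show "?q integrable_on {-T..T}" by (intro integrable_continuous_real cq)
      show "(\<lambda>t. 8 * (k * j (s, t)) + 1 / 32) integrable_on {-T..T}"
        by (intro integrable_continuous_real continuous_intros cjs)
      fix x assume "x \<in> {-T..T}"
      then show "?q x \<le> 8 * (k * j (s, x)) + 1 / 32" using qc[OF inR] by (simp add: j_def)
    qed
    also have "\<dots> = 8 * (k * integral {-T..T} (\<lambda>t. j (s, t))) + 2 * T / 32"
    proof -
      have "((\<lambda>t. j (s, t)) has_integral integral {-T..T} (\<lambda>t. j (s, t))) {-T..T}"
        by (intro integrable_integral integrable_continuous_real cjs)
      from has_integral_add[OF has_integral_mult_right[OF has_integral_mult_right[OF this, of k], of 8]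
         has_integral_const_real[of "1 / 32" "-T" T]] T
      show ?thesis by (simp add: has_integral_iff)
    qed
    finally show ?thesis using T by linarith
  qed
  have "(b - a) * (1 / 64) = integral {a..b} (\<lambda>s. 1 / 64)" using ab by simp
  also have "\<dots> \<le> integral {a..b} (\<lambda>s. k * integral {-T..T} (\<lambda>t. j (s, t)))"
    using integral_integrable_2dim[OF cj] slice by (intro integral_le integrable_on_mult_right) auto
  also have "\<dots> = k * integral (cbox (a, -T) (b, T)) j"
    using integral_prod_continuous[OF cj] by simp
  also have "\<dots> \<le> k * measure lebesgue (ball (0 :: real^2) 1)"
    unfolding j_def by (intro mult_left_mono jacobian_integral_le[OF der cont inj im] k)
  finally show ?thesis by simp
qed

section \<open>Distance of \<open>{|w| \<le> 1/2}\<close> from the circle\<close>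

lemma Re_cayley_pos:
  fixes x :: complex
  assumes "norm x < 1"
  shows "0 < Re ((1 + x) / (1 - x))"
proof -
  have "(norm x)\<^sup>2 < 1" using assms by (simp add: abs_square_less_1)
  then have "(Re x)\<^sup>2 + (Im x)\<^sup>2 < 1" by (simp add: cmod_power2)
  moreover have "x \<noteq> 1" using assms by auto
  then have "0 < (Re (1 - x))\<^sup>2 + (Im (1 - x))\<^sup>2"
    by (metis cmod_power2 norm_eq_zero right_minus_eq zero_less_power2)
  ultimately show ?thesis
    by (simp add: Re_divide power2_eq_square algebra_simps)
qed

text \<open>The conformal map of the strip \<open>|Im \<zeta>| < pi/2\<close> onto the unit disc that sends the two ends of the
  strip to \<open>- \<tau>\<close> and \<open>\<tau>\<close>.\<close>

definition strip_disc :: "complex \<Rightarrow> complex \<Rightarrow> complex" where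
  "strip_disc \<tau> \<zeta> = \<tau> * (exp \<zeta> - 1) / (exp \<zeta> + 1)"

definition disc_strip :: "complex \<Rightarrow> complex \<Rightarrow> complex" where
  "disc_strip \<tau> z = Ln ((1 + cnj \<tau> * z) / (1 - cnj \<tau> * z))"

lemma Re_exp_pos: "\<bar>Im \<zeta>\<bar> < pi / 2 \<Longrightarrow> 0 < Re (exp \<zeta>)"
  by (simp add: Re_exp cos_gt_zero_pi)

lemma strip_disc_in_ball:
  assumes "norm \<tau> = 1" "\<bar>Im \<zeta>\<bar> < pi / 2"
  shows "strip_disc \<tau> \<zeta> \<in> ball 0 1"
proof -
  define E where "E = exp \<zeta>"
  have E: "0 < Re E" using Re_exp_pos[OF assms(2)] by (simp add: E_def)
  have "(norm (E - 1))\<^sup>2 < (norm (E + 1))\<^sup>2" using E unfolding cmod_power2 by (simp add: power2_eq_square algebra_simps)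
  then have "norm (E - 1) < norm (E + 1)" using power2_less_imp_less by fastforce
  then show ?thesis using assms(1) unfolding strip_disc_def E_def[symmetric]
    by (simp add: norm_divide norm_mult divide_less_eq_1)
qed

lemma disc_strip_strip_disc:
  assumes "norm \<tau> = 1" "\<bar>Im \<zeta>\<bar> < pi / 2"
  shows "disc_strip \<tau> (strip_disc \<tau> \<zeta>) = \<zeta>"
proof -
  define E where "E = exp \<zeta>"
  have E: "E + 1 \<noteq> 0" using Re_exp_pos[OF assms(2)] unfolding E_def
    by (auto simp: complex_eq_iff)
  have "cnj \<tau> * strip_disc \<tau> \<zeta> = (cnj \<tau> * \<tau>) * ((E - 1) / (E + 1))"
    by (simp add: strip_disc_def E_def)
  also have "cnj \<tau> * \<tau> = 1" using assms(1) by (simp add: mult.commute complex_norm_square[symmetric])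
  finally have "cnj \<tau> * strip_disc \<tau> \<zeta> = (E - 1) / (E + 1)" by simp
  moreover have "1 + (E - 1) / (E + 1) = 2 * E / (E + 1)" "1 - (E - 1) / (E + 1) = 2 / (E + 1)"
    using E by (simp_all add: divide_simps)
  ultimately have "(1 + cnj \<tau> * strip_disc \<tau> \<zeta>) / (1 - cnj \<tau> * strip_disc \<tau> \<zeta>) = E"
    using E by simp
  then show ?thesis using assms(2) pi_gt_zero by (simp add: disc_strip_def E_def Ln_exp abs_less_iff)
qed

lemma disc_strip_props:
  assumes "norm \<tau> = 1" "z \<in> ball 0 1"
  shows "\<bar>Im (disc_strip \<tau> z)\<bar> < pi / 2" and "strip_disc \<tau> (disc_strip \<tau> z) = z"
    and "Re (disc_strip \<tau> z) = ln (norm (1 + cnj \<tau> * z) / norm (1 - cnj \<tau> * z))"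
proof -
  define x where "x = cnj \<tau> * z"
  define q where "q = (1 + x) / (1 - x)"
  have x: "norm x < 1" using assms by (simp add: x_def norm_mult)
  have q: "0 < Re q" unfolding q_def by (rule Re_cayley_pos[OF x])
  then have q0: "q \<noteq> 0" by auto
  have d: "disc_strip \<tau> z = Ln q" by (simp add: disc_strip_def q_def x_def)
  show "\<bar>Im (disc_strip \<tau> z)\<bar> < pi / 2" using q Re_Ln_pos_lt[OF q0] by (simp add: d)
  show "Re (disc_strip \<tau> z) = ln (norm (1 + cnj \<tau> * z) / norm (1 - cnj \<tau> * z))"
    unfolding d using q0 by (simp add: q_def x_def norm_divide)
  have x1: "1 - x \<noteq> 0" using x by auto
  have "exp (Ln q) = q" using q0 by simp
  then have "strip_disc \<tau> (disc_strip \<tau> z) = \<tau> * ((q - 1) / (q + 1))" by (simp add: strip_disc_def d)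
  also have "(q - 1) / (q + 1) = x"
    unfolding q_def using x1 by (simp add: field_simps)
  also have "\<tau> * x = (cnj \<tau> * \<tau>) * z" by (simp add: x_def)
  also have "cnj \<tau> * \<tau> = 1" using assms(1) by (simp add: mult.commute complex_norm_square[symmetric])
  finally show "strip_disc \<tau> (disc_strip \<tau> z) = z" by simp
qed

lemma continuous_on_disc_strip:
  assumes "norm \<tau> = 1"
  shows "continuous_on (ball 0 1) (disc_strip \<tau>)"
  unfolding disc_strip_def
proof (rule continuous_on_Ln')
  have ne: "1 - cnj \<tau> * z \<noteq> 0" if "z \<in> ball 0 1" for z
  proof -
    have "norm (cnj \<tau> * z) < 1" using assms that by (simp add: norm_mult)
    then show ?thesis by auto
  qed
  then show "continuous_on (ball 0 1) (\<lambda>z. (1 + cnj \<tau> * z) / (1 - cnj \<tau> * z))"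
    by (intro continuous_intros) auto
  fix z :: complex assume "z \<in> ball 0 1"
  then have "norm (cnj \<tau> * z) < 1" using assms by (simp add: norm_mult)
  from Re_cayley_pos[OF this]
  show "(1 + cnj \<tau> * z) / (1 - cnj \<tau> * z) \<notin> \<real>\<^sub>\<le>\<^sub>0" by (auto simp: complex_nonpos_Reals_iff)
qed

lemma strip_disc_derivative:
  assumes "\<bar>Im \<zeta>\<bar> < pi / 2"
  shows "(strip_disc \<tau> has_field_derivative \<tau> * (2 * exp \<zeta>) / (exp \<zeta> + 1)\<^sup>2) (at \<zeta>)"
proof -
  have E: "exp \<zeta> + 1 \<noteq> 0" using Re_exp_pos[OF assms] by (auto simp: complex_eq_iff)
  then show ?thesis unfolding strip_disc_def
    by (auto intro!: derivative_eq_intros simp: power2_eq_square algebra_simps)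
qed

text \<open>In the strip model with \<open>\<tau> = z/|z|\<close> the vertical lines are crosscuts of the disc, and those with
  real part between \<open>b0\<close> and \<open>b1\<close> separate \<open>a\<close> from \<open>z\<close>.  The preimage of the disc of radius \<open>1/2\<close> is
  connected and contains \<open>a\<close> and \<open>z\<close>, so each of these lines meets it; but near its ends the line
  leaves the compact preimage of the disc of radius \<open>3/4\<close>.  So the image of each line has length at least \<open>1/4\<close>, and
  \<open>length_area\<close> bounds \<open>b1 - b0\<close>.\<close>

lemma preimage_radius:
  fixes w w1 w2 :: "complex \<Rightarrow> complex"
  assumes hom: "homeomorphism (ball 0 1) (ball 0 1) w g"
    and der: "\<And>z. z \<in> ball 0 1 \<Longrightarrow> (w has_derivative (\<lambda>h. Re h *\<^sub>R w1 z + Im h *\<^sub>R w2 z)) (at z)"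
    and cont: "continuous_on (ball 0 1) w1" "continuous_on (ball 0 1) w2"
    and qc: "\<And>z. z \<in> ball 0 1 \<Longrightarrow> (norm (w1 z))\<^sup>2 + (norm (w2 z))\<^sup>2 \<le> k * \<bar>Im (cnj (w1 z) * w2 z)\<bar>"
    and k: "0 \<le> k" and a: "a \<in> ball 0 1" "w a = 0" and z: "z \<in> ball 0 1" "norm (w z) \<le> 1 / 2"
  shows "(1 + norm z) / (1 - norm z) \<le> (1 + norm a) / (1 - norm a) * exp (64 * k * measure lebesgue (ball (0 :: real^2) 1))"
proof -
  define V where "V = measure lebesgue (ball (0 :: real^2) 1)"
  define b0 where "b0 = ln ((1 + norm a) / (1 - norm a))"
  define b1 where "b1 = ln ((1 + norm z) / (1 - norm z))"
  have na: "0 \<le> norm a" "norm a < 1" "0 \<le> norm z" "norm z < 1" using a z by auto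
  have V0: "0 \<le> V" by (simp add: V_def)
  have "b1 - b0 \<le> 64 * k * V"
  proof (cases "b0 \<le> b1 \<and> z \<noteq> 0")
    case False
    have "0 \<le> b0" unfolding b0_def using na by (intro ln_ge_zero) (simp add: field_simps)
    with False have "b1 \<le> b0" by (auto simp: b1_def)
    moreover have "0 \<le> 64 * k * V" using k V0 by simp
    ultimately show ?thesis by linarith
  next
    case True
    then have b01: "b0 \<le> b1" and z0: "z \<noteq> 0" by auto
    define \<tau> where "\<tau> = sgn z"
    have \<tau>: "norm \<tau> = 1" using z0 by (simp add: \<tau>_def norm_sgn)
    define \<psi> where "\<psi> = strip_disc \<tau>"
    define \<Theta> where "\<Theta> = disc_strip \<tau>"
    note \<Theta> = disc_strip_props[OF \<tau>, folded \<psi>_def \<Theta>_def]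
    have \<psi>ball: "\<psi> \<zeta> \<in> ball 0 1" and \<Theta>\<psi>: "\<Theta> (\<psi> \<zeta>) = \<zeta>" if "\<bar>Im \<zeta>\<bar> < pi / 2" for \<zeta>
      using strip_disc_in_ball[OF \<tau> that] disc_strip_strip_disc[OF \<tau> that] by (simp_all add: \<psi>_def \<Theta>_def)
    have c\<Theta>: "continuous_on (ball 0 1) \<Theta>" unfolding \<Theta>_def by (rule continuous_on_disc_strip[OF \<tau>])
    have gw: "g (w x) = x" "w x \<in> ball 0 1" if "x \<in> ball 0 1" for x
      using hom that by (auto simp: homeomorphism_def)
    have wg: "w (g y) = y" "g y \<in> ball 0 1" if "y \<in> ball 0 1" for y
      using hom that by (auto simp: homeomorphism_def)
    have cg: "continuous_on (ball 0 1) g" using hom by (simp add: homeomorphism_def)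
    have Rea: "Re (\<Theta> a) \<le> b0"
    proof -
      define x where "x = cnj \<tau> * a"
      have nx: "norm x = norm a" using \<tau> by (simp add: x_def norm_mult)
      have "norm (1 + x) \<le> 1 + norm a" using norm_triangle_ineq[of 1 x] nx by simp
      moreover have "1 - norm a \<le> norm (1 - x)" using norm_triangle_ineq2[of 1 x] nx by simp
      moreover have "1 + x \<noteq> 0" using nx na(2) by (metis add.inverse_unique norm_minus_cancel norm_one order_less_irrefl)
      ultimately have "ln (norm (1 + x) / norm (1 - x)) \<le> b0" unfolding b0_def
        using na by (subst ln_le_cancel_iff) (auto intro!: frac_le divide_pos_pos add_pos_nonneg)
      then show ?thesis using \<Theta>(3)[OF a(1)] by (simp add: x_def)
    qed
    have Rez: "Re (\<Theta> z) = b1"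
    proof -
      have "cnj \<tau> * z = of_real (norm z)"
      proof -
        have "cnj \<tau> * z = z * cnj z / of_real (norm z)" by (simp add: \<tau>_def sgn_eq)
        then show ?thesis using z0 by (simp add: complex_norm_square[symmetric] power2_eq_square)
      qed
      moreover have "norm (1 + complex_of_real (norm z)) = 1 + norm z"
        by (metis norm_of_real of_real_1 of_real_add abs_of_nonneg add_nonneg_nonneg norm_ge_zero zero_le_one)
      moreover have "norm (1 - complex_of_real (norm z)) = 1 - norm z"
        using na by (metis norm_of_real of_real_1 of_real_diff abs_of_nonneg diff_ge_0_iff_ge less_imp_le)
      ultimately show ?thesis using \<Theta>(3)[OF z(1)] by (simp add: b1_def)
    qed
    define P where "P = g ` cball 0 (1 / 2)"
    have Pin: "P \<subseteq> ball 0 1" using wg by (auto simp: P_def)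
    have aP: "a \<in> P" using gw[OF a(1)] a(2) unfolding P_def by (auto intro!: image_eqI[of _ _ 0])
    have zP: "z \<in> P" using gw[OF z(1)] z(2) unfolding P_def by (auto intro!: image_eqI[of _ _ "w z"])
    have "connected P" unfolding P_def
      by (intro connected_continuous_image continuous_on_subset[OF cg]) auto
    then have "connected ((\<lambda>x. Re (\<Theta> x)) ` P)"
      by (intro connected_continuous_image continuous_intros continuous_on_subset[OF c\<Theta> Pin])
    then have hit: "\<exists>x\<in>P. Re (\<Theta> x) = s" if "b0 \<le> s" "s \<le> b1" for s
      using connectedD_interval[of "(\<lambda>x. Re (\<Theta> x)) ` P" "Re (\<Theta> a)" "Re (\<Theta> z)" s] aP zP Rea Rez that
      by auto
    define P' where "P' = g ` cball 0 (3 / 4)"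
    have P'in: "P' \<subseteq> ball 0 1" using wg by (auto simp: P'_def)
    have "compact P'" unfolding P'_def
      by (intro compact_continuous_image continuous_on_subset[OF cg]) auto
    moreover have "continuous_on P' (\<lambda>x. \<bar>Im (\<Theta> x)\<bar>)"
      by (intro continuous_intros continuous_on_subset[OF c\<Theta> P'in])
    moreover have "g 0 \<in> P'" by (auto simp: P'_def)
    then have "P' \<noteq> {}" by auto
    ultimately obtain y where y: "y \<in> P'" "\<And>x. x \<in> P' \<Longrightarrow> \<bar>Im (\<Theta> x)\<bar> \<le> \<bar>Im (\<Theta> y)\<bar>"
      using continuous_attains_sup[of P' "\<lambda>x. \<bar>Im (\<Theta> x)\<bar>"] by blast
    have yT: "\<bar>Im (\<Theta> y)\<bar> < pi / 2" using \<Theta>(1) y(1) P'in by blast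
    \<comment> \<open>At height \<open>T\<close> all vertical lines have left the preimage of the disc of radius \<open>3/4\<close>.\<close>
    define T where "T = (\<bar>Im (\<Theta> y)\<bar> + pi / 2) / 2"
    have T: "\<bar>Im (\<Theta> y)\<bar> < T" "T < pi / 2" "0 \<le> T" using yT by (auto simp: T_def)
    have strip: "\<bar>Im \<zeta>\<bar> < pi / 2" if "\<zeta> \<in> cbox (Complex b0 (-T)) (Complex b1 T)" for \<zeta>
      using that T by (auto simp: in_cbox_complex_iff)
    define D where "D = (\<lambda>\<zeta>. \<tau> * (2 * exp \<zeta>) / (exp \<zeta> + 1)\<^sup>2)"
    have D: "(\<psi> has_field_derivative D \<zeta>) (at \<zeta>)" if "\<bar>Im \<zeta>\<bar> < pi / 2" for \<zeta>
      unfolding \<psi>_def D_def by (rule strip_disc_derivative[OF that])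
    define W1 where "W1 = (\<lambda>\<zeta>. Re (D \<zeta>) *\<^sub>R w1 (\<psi> \<zeta>) + Im (D \<zeta>) *\<^sub>R w2 (\<psi> \<zeta>))"
    define W2 where "W2 = (\<lambda>\<zeta>. Re (D \<zeta>) *\<^sub>R w2 (\<psi> \<zeta>) - Im (D \<zeta>) *\<^sub>R w1 (\<psi> \<zeta>))"
    define R where "R = cbox (Complex b0 (-T)) (Complex b1 T)"
    have c\<psi>: "continuous_on R \<psi>"
      using D strip unfolding R_def by (auto intro!: continuous_at_imp_continuous_on DERIV_isCont)
    have cD: "continuous_on R D"
    proof -
      have "exp \<zeta> + 1 \<noteq> 0" if "\<zeta> \<in> R" for \<zeta>
        using Re_exp_pos[OF strip[OF that[unfolded R_def]]] by (auto simp: complex_eq_iff)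
      then show ?thesis unfolding D_def by (intro continuous_intros) auto
    qed
    have cw: "continuous_on R (\<lambda>\<zeta>. w1 (\<psi> \<zeta>))" "continuous_on R (\<lambda>\<zeta>. w2 (\<psi> \<zeta>))"
      using \<psi>ball strip unfolding R_def[symmetric]
      by (auto intro!: continuous_on_compose2[OF cont(1) c\<psi>] continuous_on_compose2[OF cont(2) c\<psi>])
    have "b1 - b0 \<le> 64 * k * V"
      unfolding V_def
    proof (rule length_area[where W = "\<lambda>\<zeta>. w (\<psi> \<zeta>)" and ?W1.0 = W1 and ?W2.0 = W2 and T = T])
      fix \<zeta> assume "\<zeta> \<in> cbox (Complex b0 (-T)) (Complex b1 T)"
      then have \<zeta>: "\<bar>Im \<zeta>\<bar> < pi / 2" by (rule strip)
      have "(\<psi> has_derivative (\<lambda>h. D \<zeta> * h)) (at \<zeta>)"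
        using D[OF \<zeta>] by (simp add: has_field_derivative_def)
      from has_derivative_compose[OF this der[OF \<psi>ball[OF \<zeta>]]]
      show "((\<lambda>\<zeta>. w (\<psi> \<zeta>)) has_derivative (\<lambda>h. Re h *\<^sub>R W1 \<zeta> + Im h *\<^sub>R W2 \<zeta>)) (at \<zeta>)"
        by (rule has_derivative_eq_rhs) (auto simp: W1_def W2_def fun_eq_iff complex_eq_iff algebra_simps)
      have "(norm (W2 \<zeta>))\<^sup>2 \<le> (norm (D \<zeta>))\<^sup>2 * ((norm (w1 (\<psi> \<zeta>)))\<^sup>2 + (norm (w2 (\<psi> \<zeta>)))\<^sup>2)"
      proof -
        have "(norm (D \<zeta>))\<^sup>2 * ((norm (w1 (\<psi> \<zeta>)))\<^sup>2 + (norm (w2 (\<psi> \<zeta>)))\<^sup>2) = (norm (W1 \<zeta>))\<^sup>2 + (norm (W2 \<zeta>))\<^sup>2"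
          unfolding cmod_power2 W1_def W2_def by (simp add: power2_eq_square algebra_simps)
        then show ?thesis by simp
      qed
      also have "\<dots> \<le> (norm (D \<zeta>))\<^sup>2 * (k * \<bar>Im (cnj (w1 (\<psi> \<zeta>)) * w2 (\<psi> \<zeta>))\<bar>)"
        by (intro mult_left_mono qc \<psi>ball \<zeta>) auto
      also have "\<dots> = k * \<bar>(norm (D \<zeta>))\<^sup>2 * Im (cnj (w1 (\<psi> \<zeta>)) * w2 (\<psi> \<zeta>))\<bar>" by (simp add: abs_mult)
      also have "(norm (D \<zeta>))\<^sup>2 * Im (cnj (w1 (\<psi> \<zeta>)) * w2 (\<psi> \<zeta>)) = Im (cnj (W1 \<zeta>) * W2 \<zeta>)"
        unfolding cmod_power2 W1_def W2_def by (simp add: power2_eq_square algebra_simps)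
      finally show "(norm (W2 \<zeta>))\<^sup>2 \<le> k * \<bar>Im (cnj (W1 \<zeta>) * W2 \<zeta>)\<bar>" .
    next
      show "continuous_on (cbox (Complex b0 (-T)) (Complex b1 T)) W1"
        "continuous_on (cbox (Complex b0 (-T)) (Complex b1 T)) W2"
        unfolding R_def[symmetric] W1_def W2_def by (intro continuous_intros cw cD)+
      show "inj_on (\<lambda>\<zeta>. w (\<psi> \<zeta>)) (cbox (Complex b0 (-T)) (Complex b1 T))"
      proof (rule inj_onI)
        fix x y assume "x \<in> cbox (Complex b0 (-T)) (Complex b1 T)" "y \<in> cbox (Complex b0 (-T)) (Complex b1 T)"
          and eq: "w (\<psi> x) = w (\<psi> y)"
        then have "\<bar>Im x\<bar> < pi / 2" "\<bar>Im y\<bar> < pi / 2" using strip by blast+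
        then show "x = y" using eq gw(1) \<psi>ball \<Theta>\<psi> by metis
      qed
      show "(\<lambda>\<zeta>. w (\<psi> \<zeta>)) ` cbox (Complex b0 (-T)) (Complex b1 T) \<subseteq> ball 0 1"
        using gw(2) \<psi>ball strip by blast
      show "T \<le> 2" using T pi_less_4 by simp
      fix s assume s: "b0 \<le> s" "s \<le> b1"
      then obtain x where x: "x \<in> P" "Re (\<Theta> x) = s" using hit by blast
      obtain v where v: "v \<in> cball 0 (1/2)" "x = g v" using x(1) by (auto simp: P_def)
      have "x \<in> P'" using v by (auto simp: P'_def)
      then have t: "\<bar>Im (\<Theta> x)\<bar> \<le> T" using y(2) T by fastforce
      have "Complex s (Im (\<Theta> x)) = \<Theta> x" using x(2) by (simp add: complex_eq_iff)
      then have "w (\<psi> (Complex s (Im (\<Theta> x)))) = v" using \<Theta>(2)[of x] x(1) Pin v wg[of v] by auto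
      then have "norm (w (\<psi> (Complex s (Im (\<Theta> x))))) \<le> 1 / 2" using v by simp
      moreover have "3 / 4 < norm (w (\<psi> (Complex s T)))"
      proof (rule ccontr)
        assume "\<not> 3 / 4 < norm (w (\<psi> (Complex s T)))"
        then have "w (\<psi> (Complex s T)) \<in> cball 0 (3/4)" by simp
        moreover have *: "\<bar>Im (Complex s T)\<bar> < pi / 2" using T by simp
        ultimately have "\<psi> (Complex s T) \<in> P'" unfolding P'_def using gw(1)[OF \<psi>ball[OF *]] by (metis image_eqI)
        from y(2)[OF this] show False using \<Theta>\<psi>[OF *] T by simp
      qed
      ultimately have "1 / 4 \<le> norm (w (\<psi> (Complex s T)) - w (\<psi> (Complex s (Im (\<Theta> x)))))"
        using norm_triangle_ineq2[of "w (\<psi> (Complex s T))" "w (\<psi> (Complex s (Im (\<Theta> x))))"] by linarith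
      then show "\<exists>t. \<bar>t\<bar> \<le> T \<and> 1 / 4 \<le> norm (w (\<psi> (Complex s T)) - w (\<psi> (Complex s t)))"
        using t by blast
    qed (use k T b01 in auto)
    then show ?thesis .
  qed
  then have "exp b1 \<le> exp (b0 + 64 * k * V)" by simp
  also have "\<dots> = exp b0 * exp (64 * k * V)" by (rule exp_add)
  finally show ?thesis using na by (simp add: b0_def b1_def V_def exp_ln)
qed

section \<open>The gradient bound on the disc\<close>

lemma qf_scaleR: "qf a b c (r *\<^sub>R \<xi>) = r\<^sup>2 * qf a b c \<xi>"
  by (simp add: qf_def power2_eq_square algebra_simps)

lemma symmetric_entry:
  fixes A :: "real^2^2"
  assumes "transpose A = A"
  shows "A $ 2 $ 1 = A $ 1 $ 2"
proof -
  have "A $ 2 $ 1 = transpose A $ 1 $ 2" by (simp add: transpose_def)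
  then show ?thesis unfolding assms .
qed

lemma qf_matrix:
  fixes A :: "real^2^2"
  assumes "transpose A = A"
  defines "h \<equiv> \<lambda>\<xi>. vector [Re \<xi>, Im \<xi>] :: real^2"
  shows "qf (A $ 1 $ 1) (A $ 1 $ 2) (A $ 2 $ 2) \<xi> = (A *v h \<xi>) \<bullet> h \<xi>"
proof -
  have "A $ 2 $ 1 = A $ 1 $ 2" by (rule symmetric_entry[OF assms(1)])
  then show ?thesis
    by (simp add: qf_def h_def inner_vec_def sum_2 matrix_vector_mult_def vector_2 power2_eq_square algebra_simps)
qed

text \<open>Unit vectors of \<open>\<real>\<^sup>2\<close> determine the form on all complex directions by homogeneity.\<close>

lemma elliptic_on_matrix:
  fixes A :: "complex \<Rightarrow> real^2^2"
  assumes sym: "\<And>z. z \<in> D \<Longrightarrow> transpose (A z) = A z"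
    and ell: "\<And>z h. z \<in> D \<Longrightarrow> norm h = 1 \<Longrightarrow> 1 / \<Lambda> \<le> (A z *v h) \<bullet> h \<and> (A z *v h) \<bullet> h \<le> \<Lambda>"
    and lip: "\<And>x y. x \<in> D \<Longrightarrow> y \<in> D \<Longrightarrow> op_norm (A x - A y) \<le> l * norm (x - y)"
  shows "elliptic_on D \<Lambda> l (\<lambda>z. A z $ 1 $ 1) (\<lambda>z. A z $ 1 $ 2) (\<lambda>z. A z $ 2 $ 2)"
proof -
  define h where "h = (\<lambda>\<xi>. vector [Re \<xi>, Im \<xi>] :: real^2)"
  have nh: "norm (h \<xi>) = norm \<xi>" for \<xi> by (simp add: h_def norm_vec2 vector_2 cmod_def)
  have "(norm \<xi>)\<^sup>2 / \<Lambda> \<le> qf (A z $ 1 $ 1) (A z $ 1 $ 2) (A z $ 2 $ 2) \<xi> \<and>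
      qf (A z $ 1 $ 1) (A z $ 1 $ 2) (A z $ 2 $ 2) \<xi> \<le> \<Lambda> * (norm \<xi>)\<^sup>2" if z: "z \<in> D" for z \<xi>
  proof (cases "\<xi> = 0")
    case True
    then show ?thesis by (simp add: qf_def)
  next
    case False
    define e where "e = sgn \<xi>"
    have e: "norm e = 1" "\<xi> = norm \<xi> *\<^sub>R e" using False by (auto simp: e_def norm_sgn sgn_div_norm)
    let ?q = "qf (A z $ 1 $ 1) (A z $ 1 $ 2) (A z $ 2 $ 2)"
    have "1 / \<Lambda> \<le> ?q e \<and> ?q e \<le> \<Lambda>"
      using ell[OF z, of "h e"] nh[of e] e(1) qf_matrix[OF sym[OF z], of e] by (simp add: h_def)
    then have "(norm \<xi>)\<^sup>2 * (1 / \<Lambda>) \<le> (norm \<xi>)\<^sup>2 * ?q e \<and> (norm \<xi>)\<^sup>2 * ?q e \<le> (norm \<xi>)\<^sup>2 * \<Lambda>"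
      by (intro conjI mult_left_mono) auto
    moreover have "?q \<xi> = (norm \<xi>)\<^sup>2 * ?q e" by (subst e(2)) (rule qf_scaleR)
    ultimately show ?thesis by (simp add: mult.commute)
  qed
  moreover have "\<bar>qf (A x $ 1 $ 1 - A y $ 1 $ 1) (A x $ 1 $ 2 - A y $ 1 $ 2) (A x $ 2 $ 2 - A y $ 2 $ 2) \<xi>\<bar>
      \<le> l * norm (x - y) * (norm \<xi>)\<^sup>2" if xy: "x \<in> D" "y \<in> D" for x y \<xi>
  proof -
    let ?M = "A x - A y"
    have "transpose ?M = ?M" using sym[OF xy(1)] sym[OF xy(2)]
      by (simp add: transpose_def vec_eq_iff)
    note qM = qf_matrix[OF this, of \<xi>]
    have "\<bar>qf (A x $ 1 $ 1 - A y $ 1 $ 1) (A x $ 1 $ 2 - A y $ 1 $ 2) (A x $ 2 $ 2 - A y $ 2 $ 2) \<xi>\<bar>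
       = \<bar>(?M *v h \<xi>) \<bullet> h \<xi>\<bar>" using qM unfolding vector_minus_component h_def by (rule arg_cong[where f = abs])
    also have "\<dots> \<le> norm (?M *v h \<xi>) * norm (h \<xi>)" by (rule Cauchy_Schwarz_ineq2)
    also have "\<dots> \<le> (op_norm ?M * norm (h \<xi>)) * norm (h \<xi>)"
      unfolding op_norm_def by (intro mult_right_mono onorm matrix_vector_mul_bounded_linear) auto
    also have "\<dots> = op_norm ?M * (norm \<xi>)\<^sup>2" by (simp add: nh power2_eq_square)
    also have "\<dots> \<le> l * norm (x - y) * (norm \<xi>)\<^sup>2" by (intro mult_right_mono lip xy) auto
    finally show ?thesis .
  qed
  ultimately show ?thesis unfolding elliptic_on_def by blast
qed

lemma C1_on_continuous_on: "C1_on D f \<Longrightarrow> open D \<Longrightarrow> continuous_on D f"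
  by (intro continuous_at_imp_continuous_on ballI has_derivative_continuous[OF C1_on_has_derivative])

lemma nabla_eq:
  assumes "C1_on D w" "z \<in> D"
  shows "nabla w z = vector [vector [Re (partial 1 w z), Re (partial 2 w z)],
     vector [Im (partial 1 w z), Im (partial 2 w z)]]"
proof -
  have hp: "has_partial j w z" for j using assms unfolding C1_on_def by blast
  show ?thesis
    unfolding nabla_def partial_bounded_linear[OF hp bounded_linear_Re] partial_bounded_linear[OF hp bounded_linear_Im]
    by (rule refl)
qed

text \<open>Both sides are continuous, so the inequality, valid almost everywhere, can fail only on an open set
  of measure zero.\<close>

lemma quasiconformal_jacobian:
  assumes w: "C1_on D w" and qc: "quasiconformal K D \<Omega> w" and z: "z \<in> D"
  shows "(norm (partial 1 w z))\<^sup>2 + (norm (partial 2 w z))\<^sup>2 \<le>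
     2 * K * \<bar>Im (cnj (partial 1 w z) * partial 2 w z)\<bar>"
proof (rule ccontr)
  define e where "e = (\<lambda>z. (norm (partial 1 w z))\<^sup>2 + (norm (partial 2 w z))\<^sup>2 -
     2 * K * \<bar>Im (cnj (partial 1 w z) * partial 2 w z)\<bar>)"
  assume "\<not> ?thesis"
  then have ez: "0 < e z" by (simp add: e_def)
  have K: "1 \<le> K" and D: "open D" and
    ae: "AE z in lborel. z \<in> D \<longrightarrow> op_norm (nabla w z) \<le> K * min_stretch (nabla w z)"
    using qc unfolding quasiconformal_def by blast+
  have "continuous_on D e" unfolding e_def using w by (intro continuous_intros) (auto simp: C1_on_def)
  then have op: "open (e -` {0<..} \<inter> D)" using D by (simp add: continuous_on_open_vimage)
  moreover have "z \<in> e -` {0<..} \<inter> D" using ez z by auto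
  ultimately have nn: "\<not> negligible (e -` {0<..} \<inter> D)" using open_not_negligible by blast
  have e0: "e x \<le> 0" if "x \<in> D" "op_norm (nabla w x) \<le> K * min_stretch (nabla w x)" for x
  proof -
    have "(Re (partial 1 w x))\<^sup>2 + (Re (partial 2 w x))\<^sup>2 + (Im (partial 1 w x))\<^sup>2 + (Im (partial 2 w x))\<^sup>2
       \<le> 2 * K * \<bar>Re (partial 1 w x) * Im (partial 2 w x) - Re (partial 2 w x) * Im (partial 1 w x)\<bar>"
      using that(2) K unfolding nabla_eq[OF w that(1)] by (intro distortion_jacobian) auto
    then show ?thesis by (simp add: e_def cmod_power2 mult.commute)
  qed
  have "AE x in lborel. x \<notin> e -` {0<..} \<inter> D"
    using ae
  proof eventually_elim
    case (elim x)
    then show ?case using e0[of x] by auto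
  qed
  moreover have "e -` {0<..} \<inter> D \<in> sets lborel" using op by simp
  ultimately have "e -` {0<..} \<inter> D \<in> null_sets lborel" by (simp add: AE_iff_null_sets)
  then have "negligible (e -` {0<..} \<inter> D)"
    unfolding negligible_iff_null_sets by (rule null_sets_completionI)
  with nn show False by blast
qed

text \<open>The constant is the larger of two: \<open>C1\<close> for points near the circle, obtained from \<open>s = |w|\<^sup>2\<close>, and \<open>C2\<close>
  for the remaining points, obtained from \<open>Re w\<close>.  The dividing line is chosen such that, near the circle,
  the ball of radius \<open>(1 - |z|)/2\<close> around \<open>z\<close> avoids the disc of radius \<open>r0\<close> and with it the
  set \<open>{|w| \<le> 1/2}\<close>.\<close>

lemma gradient_bound:
  fixes \<Lambda> l B \<Gamma> k :: real and a :: complex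
  assumes par: "1 \<le> \<Lambda>" "0 \<le> l" "0 \<le> B" "0 \<le> \<Gamma>" "0 \<le> k" and a: "a \<in> ball 0 1"
  shows "\<exists>C\<ge>0. \<forall>\<alpha> \<beta> \<gamma> w g. elliptic_on (ball 0 1) \<Lambda> l \<alpha> \<beta> \<gamma> \<longrightarrow> C2_on (ball 0 1) w \<longrightarrow>
    homeomorphism (ball 0 1) (ball 0 1) w g \<longrightarrow>
    (\<forall>z\<in>ball 0 1. (norm (partial 1 w z))\<^sup>2 + (norm (partial 2 w z))\<^sup>2 \<le>
       k * \<bar>Im (cnj (partial 1 w z) * partial 2 w z)\<bar>) \<longrightarrow> w a = 0 \<longrightarrow>
    (\<forall>z\<in>ball 0 1. norm (\<alpha> z *\<^sub>R partial 1 (partial 1 w) z +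
         \<beta> z *\<^sub>R (partial 1 (partial 2 w) z + partial 2 (partial 1 w) z) + \<gamma> z *\<^sub>R partial 2 (partial 2 w) z)
       \<le> B * ((norm (partial 1 w z))\<^sup>2 + (norm (partial 2 w z))\<^sup>2) + \<Gamma>) \<longrightarrow>
    (\<forall>z\<in>ball 0 1. (norm (partial 1 w z))\<^sup>2 + (norm (partial 2 w z))\<^sup>2 \<le> C\<^sup>2)"
proof -
  define E0 where "E0 = (1 + norm a) / (1 - norm a) * exp (64 * k * measure lebesgue (ball (0 :: real^2) 1))"
  define r0 where "r0 = (E0 - 1) / (E0 + 1)"
  define Bs where "Bs = 2 * (B + \<Lambda>) * k\<^sup>2"
  define c where "c = barrier_const \<Lambda> Bs (2 * \<Gamma>) r0"
  define C1 where "C1 = k * gradient_const \<Lambda> l Bs (2 * \<Gamma>) (6 * c)"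
  define C2 where "C2 = k * gradient_const \<Lambda> l (B * k\<^sup>2) \<Gamma> (6 / (1 - r0))"
  have "1 * 1 \<le> E0" unfolding E0_def using a par(5) by (intro mult_mono) (auto simp: field_simps)
  then have E0: "1 \<le> E0" by simp
  have r0: "0 \<le> r0" "r0 < 1" using E0 by (auto simp: r0_def)
  have Bs: "0 \<le> Bs" using par by (simp add: Bs_def)
  have c0: "0 \<le> c" unfolding c_def barrier_const_def
    using par Bs r0 by (auto intro!: mult_nonneg_nonneg divide_nonneg_nonneg add_nonneg_nonneg simp: power_le_one)
  have gc: "0 \<le> gradient_const \<Lambda> l B' \<Gamma>' M" if "0 \<le> M" for B' \<Gamma>' M
    using that par by (simp add: gradient_const_def)
  have C0: "0 \<le> C1" "0 \<le> C2" using gc c0 r0 par by (auto simp: C1_def C2_def)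
  show ?thesis
  proof (intro exI[of _ "max C1 C2"] conjI allI impI ballI)
    show "0 \<le> max C1 C2" using C0 by simp
    fix \<alpha> \<beta> \<gamma> w g and z :: complex
    assume ell: "elliptic_on (ball 0 1) \<Lambda> l \<alpha> \<beta> \<gamma>" and w: "C2_on (ball 0 1) w"
      and hom: "homeomorphism (ball 0 1) (ball 0 1) w g"
      and qc: "\<forall>z\<in>ball 0 1. (norm (partial 1 w z))\<^sup>2 + (norm (partial 2 w z))\<^sup>2 \<le>
       k * \<bar>Im (cnj (partial 1 w z) * partial 2 w z)\<bar>" and wa: "w a = 0"
      and eqn: "\<forall>z\<in>ball 0 1. norm (\<alpha> z *\<^sub>R partial 1 (partial 1 w) z +
         \<beta> z *\<^sub>R (partial 1 (partial 2 w) z + partial 2 (partial 1 w) z) + \<gamma> z *\<^sub>R partial 2 (partial 2 w) z)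
       \<le> B * ((norm (partial 1 w z))\<^sup>2 + (norm (partial 2 w z))\<^sup>2) + \<Gamma>"
      and z: "z \<in> ball 0 1"
    define F where "F = (\<lambda>z. (norm (partial 1 w z))\<^sup>2 + (norm (partial 2 w z))\<^sup>2)"
    define u v where "u = (\<lambda>z. Re (w z))" and "v = (\<lambda>z. Im (w z))"
    define p q where "p = (\<lambda>z. Complex (Re (partial 1 w z)) (Re (partial 2 w z)))"
      and "q = (\<lambda>z. Complex (Im (partial 1 w z)) (Im (partial 2 w z)))"
    define H11 H12 H22 where "H11 = partial 1 (partial 1 w)"
      and "H12 = (\<lambda>z. (partial 1 (partial 2 w) z + partial 2 (partial 1 w) z) / 2)"
      and "H22 = partial 2 (partial 2 w)"
    define Lw where "Lw = (\<lambda>z. \<alpha> z *\<^sub>R H11 z + (2 * \<beta> z) *\<^sub>R H12 z + \<gamma> z *\<^sub>R H22 z)"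
    have w1: "C1_on (ball 0 1) w" using w by (simp add: C2_on_def)
    have cw: "continuous_on (ball 0 1) w" using C1_on_continuous_on[OF w1] by simp
    have ju: "has_jet2 u (p z) (Re (H11 z)) (Re (H12 z)) (Re (H22 z)) z"
      and jv: "has_jet2 v (q z) (Im (H11 z)) (Im (H12 z)) (Im (H22 z)) z" if "z \<in> ball 0 1" for z
      using C2_on_has_jet2[OF w open_ball that bounded_linear_Re] C2_on_has_jet2[OF w open_ball that bounded_linear_Im]
      by (simp_all add: u_def v_def p_def q_def H11_def H12_def H22_def)
    have Fpq: "F z = (norm (p z))\<^sup>2 + (norm (q z))\<^sup>2" for z
      by (simp add: F_def p_def q_def cmod_power2)
    have comparison: "(norm s)\<^sup>2 * F z \<le> k\<^sup>2 * (norm (Re s *\<^sub>R p z + Im s *\<^sub>R q z))\<^sup>2" if "z \<in> ball 0 1" for s z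
    proof -
      have "Im (cnj (partial 1 w z) * partial 2 w z) = Re (p z) * Im (q z) - Im (p z) * Re (q z)"
        by (simp add: p_def q_def)
      with qc[rule_format, OF that] have "F z \<le> k * \<bar>Re (p z) * Im (q z) - Im (p z) * Re (q z)\<bar>"
        by (simp only: F_def)
      then show ?thesis unfolding Fpq using par(5) by (rule gradient_comparison)
    qed
    have Lw: "norm (Lw z) \<le> B * F z + \<Gamma>" if "z \<in> ball 0 1" for z
      using eqn that by (auto simp: Lw_def F_def H11_def H12_def H22_def scaleR_conv_of_real)
    have w_lt: "norm (w z) < 1" if "z \<in> ball 0 1" for z
      using hom that by (auto simp: homeomorphism_def)
    have gw: "g (w x) = x" if "x \<in> ball 0 1" for x
      using hom that by (auto simp: homeomorphism_def)
    have radius: "norm z \<le> r0" if z: "z \<in> ball 0 1" "norm (w z) \<le> 1 / 2" for z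
    proof -
      have "(1 + norm z) / (1 - norm z) \<le> E0" unfolding E0_def
        by (rule preimage_radius[OF hom C1_on_has_derivative[OF w1 open_ball] _ _ _ par(5) a wa z])
          (use w1 qc in \<open>auto simp: C1_on_def\<close>)
      then have "1 + norm z \<le> E0 * (1 - norm z)" using z(1) by (simp add: pos_divide_le_eq)
      then show ?thesis unfolding r0_def using E0 by (simp add: pos_le_divide_eq algebra_simps)
    qed
    define s where "s = (\<lambda>z. (u z)\<^sup>2 + (v z)\<^sup>2)"
    have sw: "s z = (norm (w z))\<^sup>2" for z by (simp add: s_def u_def v_def cmod_power2)
    define ps where "ps = (\<lambda>z. 2 *\<^sub>R (u z *\<^sub>R p z + v z *\<^sub>R q z))"
    define S11 where "S11 = (\<lambda>z. 2 * ((Re (p z))\<^sup>2 + (Re (q z))\<^sup>2 + u z * Re (H11 z) + v z * Im (H11 z)))"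
    define S12 where "S12 = (\<lambda>z. 2 * (Re (p z) * Im (p z) + Re (q z) * Im (q z) + u z * Re (H12 z) + v z * Im (H12 z)))"
    define S22 where "S22 = (\<lambda>z. 2 * ((Im (p z))\<^sup>2 + (Im (q z))\<^sup>2 + u z * Re (H22 z) + v z * Im (H22 z)))"
    have js: "has_jet2 s (ps z) (S11 z) (S12 z) (S22 z) z" if "z \<in> ball 0 1" for z
      unfolding s_def ps_def S11_def S12_def S22_def by (rule has_jet2_normsq[OF ju[OF that] jv[OF that]])
    have E: "(norm \<xi>)\<^sup>2 / \<Lambda> \<le> qf (\<alpha> z) (\<beta> z) (\<gamma> z) \<xi>" "qf (\<alpha> z) (\<beta> z) (\<gamma> z) \<xi> \<le> \<Lambda> * (norm \<xi>)\<^sup>2"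
      if "z \<in> ball 0 1" for z \<xi> using ell that unfolding elliptic_on_def by blast+
    have Fs: "F z \<le> k\<^sup>2 * (norm (ps z))\<^sup>2" if "z \<in> ball 0 1" "1 / 4 \<le> s z" for z
    proof -
      have "1 / 4 * F z \<le> (norm (w z))\<^sup>2 * F z" using that(2) unfolding sw by (intro mult_right_mono) (auto simp: F_def)
      also have "\<dots> \<le> k\<^sup>2 * (norm (u z *\<^sub>R p z + v z *\<^sub>R q z))\<^sup>2"
        using comparison[OF that(1), of "w z"] by (simp add: u_def v_def)
      also have "\<dots> = 1 / 4 * (k\<^sup>2 * (norm (ps z))\<^sup>2)"
        by (simp add: ps_def power_mult_distrib)
      finally show ?thesis by simp
    qed
    have eqs: "\<bar>\<alpha> z * S11 z + 2 * \<beta> z * S12 z + \<gamma> z * S22 z\<bar> \<le> Bs * (norm (ps z))\<^sup>2 + 2 * \<Gamma>"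
      if z: "z \<in> ball 0 1" "1 / 4 \<le> s z" for z
    proof -
      have "\<alpha> z * S11 z + 2 * \<beta> z * S12 z + \<gamma> z * S22 z =
        2 * (qf (\<alpha> z) (\<beta> z) (\<gamma> z) (p z) + qf (\<alpha> z) (\<beta> z) (\<gamma> z) (q z)) + 2 * Re (cnj (w z) * Lw z)"
        by (simp add: S11_def S12_def S22_def qf_def Lw_def u_def v_def power2_eq_square algebra_simps)
      moreover have "\<bar>Re (cnj (w z) * Lw z)\<bar> \<le> B * F z + \<Gamma>"
      proof -
        have "\<bar>Re (cnj (w z) * Lw z)\<bar> \<le> norm (w z) * norm (Lw z)"
          using abs_Re_le_cmod[of "cnj (w z) * Lw z"] by (simp add: norm_mult)
        also have "\<dots> \<le> 1 * norm (Lw z)" using w_lt[OF z(1)] by (intro mult_right_mono) auto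
        finally show ?thesis using Lw[OF z(1)] by simp
      qed
      moreover have "0 \<le> (norm \<xi>)\<^sup>2 / \<Lambda>" for \<xi> :: complex using par by simp
      then have "0 \<le> qf (\<alpha> z) (\<beta> z) (\<gamma> z) (p z)" "0 \<le> qf (\<alpha> z) (\<beta> z) (\<gamma> z) (q z)"
        using E(1)[OF z(1)] order_trans by blast+
      moreover have "qf (\<alpha> z) (\<beta> z) (\<gamma> z) (p z) + qf (\<alpha> z) (\<beta> z) (\<gamma> z) (q z) \<le> \<Lambda> * F z"
        using E(2)[OF z(1), of "p z"] E(2)[OF z(1), of "q z"] by (simp add: Fpq algebra_simps)
      ultimately have "\<bar>\<alpha> z * S11 z + 2 * \<beta> z * S12 z + \<gamma> z * S22 z\<bar> \<le> 2 * (B + \<Lambda>) * F z + 2 * \<Gamma>"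
        unfolding abs_le_iff by (simp add: algebra_simps)
      also have "2 * (B + \<Lambda>) * F z \<le> 2 * (B + \<Lambda>) * (k\<^sup>2 * (norm (ps z))\<^sup>2)"
        using Fs[OF z] par by (intro mult_left_mono) auto
      finally show ?thesis by (simp add: Bs_def mult_ac)
    qed
    have quarter: "s z \<le> 1 / 4 \<longleftrightarrow> norm (w z) \<le> 1 / 2" for z
      unfolding sw using abs_le_square_iff[of "norm (w z)" "1 / 2"] by (simp add: power2_eq_square)
    have cs: "continuous_on (ball 0 1) s" unfolding s_def u_def v_def by (intro continuous_intros cw)
    have barrier: "1 - s z \<le> c * (1 - (norm z)\<^sup>2)" if "z \<in> ball 0 1" for z
      unfolding c_def
    proof (rule boundary_barrier[OF par(1) Bs _ r0 E(1) js eqs cs _ _ _ that])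
      show "0 \<le> s z \<and> s z < 1" if "z \<in> ball 0 1" for z
        using w_lt[OF that] by (auto simp: sw abs_square_less_1)
      show "norm z \<le> r0" if "z \<in> ball 0 1" "s z \<le> 1 / 4" for z using radius that quarter by blast
      fix d :: real assume d: "d < 1"
      show "compact {z \<in> ball 0 1. s z \<le> d}"
      proof (cases "0 \<le> d")
        case True
        have "{z \<in> ball 0 1. s z \<le> d} = g ` cball 0 (sqrt d)"
        proof (intro set_eqI iffI)
          fix x assume "x \<in> {z \<in> ball 0 1. s z \<le> d}"
          then have "norm (w x) \<le> sqrt d" "x = g (w x)" using gw[of x] by (auto simp: sw real_le_rsqrt)
          then show "x \<in> g ` cball 0 (sqrt d)" by (metis image_eqI mem_cball_0)
        next
          fix x assume "x \<in> g ` cball 0 (sqrt d)"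
          then obtain y where y: "norm y \<le> sqrt d" "x = g y" by auto
          have "norm y < 1" using y(1) d True real_sqrt_lt_1_iff[of d] by linarith
          then have "x \<in> ball 0 1" "w x = y" using hom y(2) by (auto simp: homeomorphism_def)
          moreover have "(norm y)\<^sup>2 \<le> d" using y(1) True by (metis norm_ge_zero power_mono real_sqrt_pow2)
          ultimately show "x \<in> {z \<in> ball 0 1. s z \<le> d}" by (simp add: sw)
        qed
        moreover have "continuous_on (cball 0 (sqrt d)) g"
        proof (rule continuous_on_subset)
          show "continuous_on (ball 0 1) g" using hom by (simp add: homeomorphism_def)
          have "sqrt d < 1" using d by simp
          then show "cball 0 (sqrt d) \<subseteq> ball 0 1" using order.strict_trans1 by (force simp del: real_sqrt_lt_1_iff)
        qed
        ultimately show ?thesis by (simp add: compact_continuous_image)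
      next
        case False
        then have "\<not> s x \<le> d" for x using zero_le_power2[of "norm (w x)"] unfolding sw by linarith
        then show ?thesis by simp
      qed
    qed (use par in auto)
    have sub_ell: "elliptic_on S \<Lambda> l \<alpha> \<beta> \<gamma>" if "S \<subseteq> ball 0 1" for S
      using ell that unfolding elliptic_on_def by blast
    define \<rho> where "\<rho> = (1 - norm z) / 2"
    have nz: "norm z < 1" using z by simp
    have "0 < \<rho>" using nz by (simp add: \<rho>_def)
    moreover have "\<rho> \<le> 1" using order_trans[of "- 1" 0 "norm z"] by (simp add: \<rho>_def)
    ultimately have \<rho>: "0 < \<rho>" "\<rho> \<le> 1" .
    have \<rho>x: "norm x < 1" "1 - norm x \<le> 3 * \<rho>" if "x \<in> ball z \<rho>" for x
    proof -
      have "\<bar>norm x - norm z\<bar> < \<rho>" using that norm_triangle_ineq3[of x z] by (simp add: dist_norm norm_minus_commute)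
      then have "norm x - norm z < \<rho>" "norm z - norm x < \<rho>" by (simp_all add: abs_less_iff)
      then show "norm x < 1" "1 - norm x \<le> 3 * \<rho>" using nz by (simp_all add: \<rho>_def)
    qed
    have sub: "ball z \<rho> \<subseteq> ball 0 1" using \<rho>x by auto
    have "F z \<le> (max C1 C2)\<^sup>2"
    proof (cases "3 * \<rho> < 1 - r0")
      case True
      have far: "1 / 4 \<le> s x" if "x \<in> ball z \<rho>" for x
        using radius[of x] quarter[of x] \<rho>x[OF that] True by force
      have "norm (ps z) \<le> gradient_const \<Lambda> l Bs (2 * \<Gamma>) (6 * c)"
      proof (rule interior_gradient_bound[OF par(1,2) Bs _ _ \<rho> sub_ell[OF sub]])
        show "has_jet2 s (ps x) (S11 x) (S12 x) (S22 x) x" if "x \<in> ball z \<rho>" for x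
          using js that sub by blast
        show "\<bar>\<alpha> x * S11 x + 2 * \<beta> x * S12 x + \<gamma> x * S22 x\<bar> \<le> Bs * (norm (ps x))\<^sup>2 + 2 * \<Gamma>"
          if "x \<in> ball z \<rho>" for x using eqs far that sub by blast
        show "continuous_on (ball z \<rho>) s" using cs sub by (rule continuous_on_subset)
        show "s x - s y \<le> 6 * c * \<rho>" if "x \<in> ball z \<rho>" "y \<in> ball z \<rho>" for x y
        proof -
          have "s x \<le> 1" using w_lt[of x] that sub by (auto simp: sw power_le_one)
          moreover have "1 - s y \<le> c * (1 - (norm y)\<^sup>2)" using barrier that sub by blast
          moreover have "c * (1 - (norm y)\<^sup>2) \<le> c * (6 * \<rho>)"
          proof (rule mult_left_mono[OF _ c0])
            have "1 - (norm y)\<^sup>2 = (1 + norm y) * (1 - norm y)" by (simp add: power2_eq_square algebra_simps)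
            also have "\<dots> \<le> 2 * (3 * \<rho>)" using \<rho>x[OF that(2)] by (intro mult_mono) auto
            finally show "1 - (norm y)\<^sup>2 \<le> 6 * \<rho>" by simp
          qed
          ultimately show ?thesis by (simp add: mult_ac)
        qed
      qed (use par c0 in auto)
      then have "k\<^sup>2 * (norm (ps z))\<^sup>2 \<le> C1\<^sup>2"
        unfolding C1_def power_mult_distrib by (intro mult_left_mono power_mono) auto
      also have "\<dots> \<le> (max C1 C2)\<^sup>2" using C0 by (intro power_mono) auto
      finally show ?thesis using Fs[of z] far[of z] z \<rho> by simp
    next
      case False
      have Fp: "F x \<le> k\<^sup>2 * (norm (p x))\<^sup>2" if "x \<in> ball 0 1" for x using comparison[OF that, of 1] by simp
      have "norm (p z) \<le> gradient_const \<Lambda> l (B * k\<^sup>2) \<Gamma> (6 / (1 - r0))"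
      proof (rule interior_gradient_bound[OF par(1,2) _ par(4) _ \<rho> sub_ell[OF sub]])
        show "has_jet2 u (p x) (Re (H11 x)) (Re (H12 x)) (Re (H22 x)) x" if "x \<in> ball z \<rho>" for x
          using ju that sub by blast
        show "\<bar>\<alpha> x * Re (H11 x) + 2 * \<beta> x * Re (H12 x) + \<gamma> x * Re (H22 x)\<bar> \<le> B * k\<^sup>2 * (norm (p x))\<^sup>2 + \<Gamma>"
          if "x \<in> ball z \<rho>" for x
        proof -
          have x: "x \<in> ball 0 1" using that sub by blast
          have "\<bar>Re (Lw x)\<bar> \<le> B * F x + \<Gamma>" using abs_Re_le_cmod[of "Lw x"] Lw[OF x] by linarith
          also have "B * F x \<le> B * (k\<^sup>2 * (norm (p x))\<^sup>2)" using Fp[OF x] par by (intro mult_left_mono) auto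
          finally show ?thesis by (simp add: Lw_def mult.assoc)
        qed
        show "continuous_on (ball z \<rho>) u" unfolding u_def
          using cw sub by (intro continuous_intros) (rule continuous_on_subset)
        show "u x - u y \<le> 6 / (1 - r0) * \<rho>" if "x \<in> ball z \<rho>" "y \<in> ball z \<rho>" for x y
        proof -
          have "\<bar>u x\<bar> < 1" "\<bar>u y\<bar> < 1"
            using w_lt[of x] w_lt[of y] abs_Re_le_cmod[of "w x"] abs_Re_le_cmod[of "w y"] that sub
            unfolding u_def by force+
          moreover have "2 \<le> 6 / (1 - r0) * \<rho>" using False r0 by (simp add: field_simps)
          ultimately show ?thesis by linarith
        qed
      qed (use par r0 in auto)
      then have "k\<^sup>2 * (norm (p z))\<^sup>2 \<le> C2\<^sup>2"
        unfolding C2_def power_mult_distrib by (intro mult_left_mono power_mono) auto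
      also have "\<dots> \<le> (max C1 C2)\<^sup>2" using C0 by (intro power_mono) auto
      finally show ?thesis using Fp[OF z] by simp
    qed
    then show "(norm (partial 1 w z))\<^sup>2 + (norm (partial 2 w z))\<^sup>2 \<le> (max C1 C2)\<^sup>2" by (simp add: F_def)
  qed
qed

lemma second_order_op_eq:
  assumes "transpose (A z) = A z"
  shows "second_order_op A w z = A z $ 1 $ 1 *\<^sub>R partial 1 (partial 1 w) z +
         A z $ 1 $ 2 *\<^sub>R (partial 1 (partial 2 w) z + partial 2 (partial 1 w) z) +
         A z $ 2 $ 2 *\<^sub>R partial 2 (partial 2 w) z"
proof -
  have "A z $ 2 $ 1 = A z $ 1 $ 2" by (rule symmetric_entry[OF assms])
  moreover have "second_order_op A w z =
      (A z $ 1 $ 1 *\<^sub>R partial 1 (partial 1 w) z + A z $ 1 $ 2 *\<^sub>R partial 1 (partial 2 w) z) +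
      (A z $ 2 $ 1 *\<^sub>R partial 2 (partial 1 w) z + A z $ 2 $ 2 *\<^sub>R partial 2 (partial 2 w) z)"
    unfolding second_order_op_def by (simp only: sum_2)
  ultimately show ?thesis by (simp only: scaleR_add_right add.assoc)
qed

lemma lipschitz_of_gradient:
  fixes w :: "complex \<Rightarrow> complex"
  assumes D: "open D" "convex D" and w: "C1_on D w" and C: "0 \<le> C"
    and F: "\<And>z. z \<in> D \<Longrightarrow> (norm (partial 1 w z))\<^sup>2 + (norm (partial 2 w z))\<^sup>2 \<le> C\<^sup>2"
  shows "C-lipschitz_on D w"
proof (rule lipschitz_onI[OF _ C])
  fix x y assume xy: "x \<in> D" "y \<in> D"
  have "norm (w x - w y) \<le> C * norm (x - y)"
  proof (rule differentiable_bound[OF D(2) _ _ xy])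
    fix z assume z: "z \<in> D"
    show "(w has_derivative (\<lambda>h. Re h *\<^sub>R partial 1 w z + Im h *\<^sub>R partial 2 w z)) (at z within D)"
      by (rule has_derivative_at_withinI[OF C1_on_has_derivative[OF w D(1) z]])
    show "onorm (\<lambda>h. Re h *\<^sub>R partial 1 w z + Im h *\<^sub>R partial 2 w z) \<le> C"
    proof (rule onorm_le)
      fix h :: complex
      let ?a = "norm (partial 1 w z)" and ?b = "norm (partial 2 w z)"
      have "norm (Re h *\<^sub>R partial 1 w z + Im h *\<^sub>R partial 2 w z) \<le> \<bar>Re h\<bar> * ?a + \<bar>Im h\<bar> * ?b"
        by (rule order_trans[OF norm_triangle_ineq]) simp
      also have "\<dots> \<le> sqrt ((?a\<^sup>2 + ?b\<^sup>2) * (norm h)\<^sup>2)"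
      proof (rule real_le_rsqrt)
        have "(\<bar>Re h\<bar> * ?a + \<bar>Im h\<bar> * ?b)\<^sup>2 + (\<bar>Re h\<bar> * ?b - \<bar>Im h\<bar> * ?a)\<^sup>2 = (?a\<^sup>2 + ?b\<^sup>2) * (\<bar>Re h\<bar>\<^sup>2 + \<bar>Im h\<bar>\<^sup>2)"
          by (simp add: power2_eq_square algebra_simps)
        also have "\<dots> = (?a\<^sup>2 + ?b\<^sup>2) * (norm h)\<^sup>2" by (simp add: cmod_power2)
        finally show "(\<bar>Re h\<bar> * ?a + \<bar>Im h\<bar> * ?b)\<^sup>2 \<le> (?a\<^sup>2 + ?b\<^sup>2) * (norm h)\<^sup>2"
          by (smt (verit) zero_le_power2)
      qed
      also have "\<dots> \<le> sqrt (C\<^sup>2 * (norm h)\<^sup>2)" using F[OF z] by (intro real_sqrt_le_mono mult_right_mono) auto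
      also have "\<dots> = C * norm h" using C by (simp add: real_sqrt_mult)
      finally show "norm (Re h *\<^sub>R partial 1 w z + Im h *\<^sub>R partial 2 w z) \<le> C * norm h" .
    qed
  qed
  then show "dist (w x) (w y) \<le> C * dist x y" by (simp add: dist_norm)
qed

theorem theorem1p1:
  fixes K \<Lambda> \<LL> \<B> \<Gamma> :: real and a :: complex
  assumes "1 \<le> K" and "1 \<le> \<Lambda>" and "0 \<le> \<LL>" and "0 \<le> \<B>" and "0 \<le> \<Gamma>"
    and "a \<in> ball 0 1"
  shows "\<exists>C::real. \<forall>(A :: complex \<Rightarrow> real^2^2) (w :: complex \<Rightarrow> complex).
    (\<forall>z\<in>ball 0 1. transpose (A z) = A z) \<longrightarrow>
    (\<forall>z\<in>ball 0 1. \<forall>h. norm h = 1 \<longrightarrow> 1 / \<Lambda> \<le> (A z *v h) \<bullet> h \<and> (A z *v h) \<bullet> h \<le> \<Lambda>) \<longrightarrow>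
    (\<forall>z\<in>ball 0 1. \<forall>\<zeta>\<in>ball 0 1. op_norm (A z - A \<zeta>) \<le> \<LL> * norm (z - \<zeta>)) \<longrightarrow>
    C2_on (ball 0 1) w \<longrightarrow>
    quasiconformal K (ball 0 1) (ball 0 1) w \<longrightarrow>
    w a = 0 \<longrightarrow>
    (\<forall>z\<in>ball 0 1. norm (second_order_op A w z) \<le> \<B> * (op_norm (nabla w z))\<^sup>2 + \<Gamma>) \<longrightarrow>
    (\<forall>z\<in>ball 0 1. op_norm (nabla w z) \<le> C) \<and>
    (\<exists>M. M-lipschitz_on (ball 0 1) w)"
proof -
  have "0 \<le> 2 * K" using assms(1) by simp
  from gradient_bound[OF assms(2-5) this assms(6)] obtain C where C0: "0 \<le> C" and
    C: "\<And>\<alpha> \<beta> \<gamma> w g z. elliptic_on (ball 0 1) \<Lambda> \<LL> \<alpha> \<beta> \<gamma> \<Longrightarrow> C2_on (ball 0 1) w \<Longrightarrow>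
    homeomorphism (ball 0 1) (ball 0 1) w g \<Longrightarrow>
    (\<forall>z\<in>ball 0 1. (norm (partial 1 w z))\<^sup>2 + (norm (partial 2 w z))\<^sup>2 \<le>
       2 * K * \<bar>Im (cnj (partial 1 w z) * partial 2 w z)\<bar>) \<Longrightarrow> w a = 0 \<Longrightarrow>
    (\<forall>z\<in>ball 0 1. norm (\<alpha> z *\<^sub>R partial 1 (partial 1 w) z +
         \<beta> z *\<^sub>R (partial 1 (partial 2 w) z + partial 2 (partial 1 w) z) + \<gamma> z *\<^sub>R partial 2 (partial 2 w) z)
       \<le> \<B> * ((norm (partial 1 w z))\<^sup>2 + (norm (partial 2 w z))\<^sup>2) + \<Gamma>) \<Longrightarrow>
    z \<in> ball 0 1 \<Longrightarrow> (norm (partial 1 w z))\<^sup>2 + (norm (partial 2 w z))\<^sup>2 \<le> C\<^sup>2"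
    by metis
  show ?thesis
  proof (intro exI[of _ C] allI impI)
    fix A :: "complex \<Rightarrow> real^2^2" and w :: "complex \<Rightarrow> complex"
    assume sym: "\<forall>z\<in>ball 0 1. transpose (A z) = A z"
      and ell: "\<forall>z\<in>ball 0 1. \<forall>h. norm h = 1 \<longrightarrow> 1 / \<Lambda> \<le> (A z *v h) \<bullet> h \<and> (A z *v h) \<bullet> h \<le> \<Lambda>"
      and lip: "\<forall>z\<in>ball 0 1. \<forall>\<zeta>\<in>ball 0 1. op_norm (A z - A \<zeta>) \<le> \<LL> * norm (z - \<zeta>)"
      and w: "C2_on (ball 0 1) w" and qc: "quasiconformal K (ball 0 1) (ball 0 1) w" and wa: "w a = 0"
      and eqn: "\<forall>z\<in>ball 0 1. norm (second_order_op A w z) \<le> \<B> * (op_norm (nabla w z))\<^sup>2 + \<Gamma>"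
    have w1: "C1_on (ball 0 1) w" using w by (simp add: C2_on_def)
    obtain g where g: "homeomorphism (ball 0 1) (ball 0 1) w g"
      using qc unfolding quasiconformal_def sense_preserving_homeo_def by blast
    have op: "op_norm (nabla w z) \<le> sqrt ((norm (partial 1 w z))\<^sup>2 + (norm (partial 2 w z))\<^sup>2)"
      if "z \<in> ball 0 1" for z
      unfolding nabla_eq[OF w1 that] by (rule order_trans[OF op_norm_le_frobenius]) (simp add: cmod_power2 algebra_simps)
    have op0: "0 \<le> op_norm M" for M :: "real^2^2"
      unfolding op_norm_def by (intro onorm_pos_le matrix_vector_mul_bounded_linear)
    have F: "(norm (partial 1 w z))\<^sup>2 + (norm (partial 2 w z))\<^sup>2 \<le> C\<^sup>2" if z: "z \<in> ball 0 1" for z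
    proof (rule C[OF elliptic_on_matrix w g _ wa _ z])
      show "\<forall>z\<in>ball 0 1. norm (A z $ 1 $ 1 *\<^sub>R partial 1 (partial 1 w) z +
         A z $ 1 $ 2 *\<^sub>R (partial 1 (partial 2 w) z + partial 2 (partial 1 w) z) +
         A z $ 2 $ 2 *\<^sub>R partial 2 (partial 2 w) z)
       \<le> \<B> * ((norm (partial 1 w z))\<^sup>2 + (norm (partial 2 w z))\<^sup>2) + \<Gamma>"
      proof
        fix z :: complex assume z: "z \<in> ball 0 1"
        have "(op_norm (nabla w z))\<^sup>2 \<le> (norm (partial 1 w z))\<^sup>2 + (norm (partial 2 w z))\<^sup>2"
          using power_mono[OF op[OF z] op0, of 2] by simp
        then have "\<B> * (op_norm (nabla w z))\<^sup>2 \<le> \<B> * ((norm (partial 1 w z))\<^sup>2 + (norm (partial 2 w z))\<^sup>2)"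
          using assms(4) by (rule mult_left_mono)
        then show "norm (A z $ 1 $ 1 *\<^sub>R partial 1 (partial 1 w) z +
         A z $ 1 $ 2 *\<^sub>R (partial 1 (partial 2 w) z + partial 2 (partial 1 w) z) +
         A z $ 2 $ 2 *\<^sub>R partial 2 (partial 2 w) z)
         \<le> \<B> * ((norm (partial 1 w z))\<^sup>2 + (norm (partial 2 w z))\<^sup>2) + \<Gamma>"
          using eqn z sym second_order_op_eq[of A z w] by force
      qed
    qed (use sym ell lip quasiconformal_jacobian[OF w1 qc] in auto)
    have "op_norm (nabla w z) \<le> C" if "z \<in> ball 0 1" for z
      using op[OF that] real_sqrt_le_mono[OF F[OF that]] C0 by simp
    moreover have "C-lipschitz_on (ball 0 1) w"
      by (rule lipschitz_of_gradient[OF _ _ w1 C0 F]) auto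
    ultimately show "(\<forall>z\<in>ball 0 1. op_norm (nabla w z) \<le> C) \<and> (\<exists>M. M-lipschitz_on (ball 0 1) w)"
      by blast
  qed
qed

end
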